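(* Let $f$ be a transcendental entire function, or a transcendental meromorphic function on $\mathbb{C}$, and let $s\in S(f)$ be a finite singular value of $f$. If $U\subset\mathbb{C}$ is an open neighbourhood of $s$, then $$\inf_{z\in f^{-1}(U)}(1+|z|^{\tau})\cdot|f'(z)|=0$$ for all $\tau>0$.
   Context: Singular values: $s\in\mathbb{C}$ is a regular value of $f$ if there is an open neighbourhood $U$ of $s$ such that for every connected component $V$ of $f^{-1}(U)$ the map $f\colon V\to U$ is a conformal isomorphism; otherwise $s$ is a singular value. $S(f)$ denotes the set of (finite) singular values; equivalently, it is the closure in $\mathbb{C}$ of the set of finite critical and asymptotic values of $f$. *)

theory Defs
  imports "HOL-Complex_Analysis.Complex_Analysis"
begin

definition rational_function :: "(complex \<Rightarrow> complex) \<Rightarrow> bool" where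
  "rational_function f \<longleftrightarrow>
     (\<exists>p q :: complex poly. q \<noteq> 0 \<and> (\<forall>z. poly q z \<noteq> 0 \<longrightarrow> f z = poly p z / poly q z))"

definition transcendental_entire :: "(complex \<Rightarrow> complex) \<Rightarrow> bool" where
  "transcendental_entire f \<longleftrightarrow> f holomorphic_on UNIV \<and> (\<nexists>p :: complex poly. f = poly p)"

text \<open>
  A meromorphic function is a total function that is continuous at every point other than its
  poles (no removable singularities); the value \<open>0\<close> it takes at a pole is a dummy value for infinity.
\<close>
definition transcendental_meromorphic :: "(complex \<Rightarrow> complex) \<Rightarrow> bool" where
  "transcendental_meromorphic f \<longleftrightarrow> f nicely_meromorphic_on UNIV \<and> \<not> rational_function f"

text \<open>
  The preimage of a set of finite values. Poles are mapped to infinity and so must be removed: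
  the dummy value \<open>0\<close> at a pole does not count.
\<close>
definition finite_preimage :: "(complex \<Rightarrow> complex) \<Rightarrow> complex set \<Rightarrow> complex set" where
  "finite_preimage f U = {z. \<not> is_pole f z \<and> f z \<in> U}"

definition conformal_isomorphism ::
    "(complex \<Rightarrow> complex) \<Rightarrow> complex set \<Rightarrow> complex set \<Rightarrow> bool" where
  "conformal_isomorphism f V U \<longleftrightarrow>
     f holomorphic_on V \<and> bij_betw f V U \<and> inv_into V f holomorphic_on U"

definition regular_value :: "(complex \<Rightarrow> complex) \<Rightarrow> complex \<Rightarrow> bool" where
  "regular_value f s \<longleftrightarrow>
     (\<exists>U. open U \<and> s \<in> U \<and> (\<forall>V \<in> components (finite_preimage f U). conformal_isomorphism f V U))"

definition singular_values :: "(complex \<Rightarrow> complex) \<Rightarrow> complex set" where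
  "singular_values f = {s. \<not> regular_value f s}"

end

theory Submission
  imports Defs
begin

text \<open>
  Suppose that the infimum is positive. Bounding \<open>1 + |z| powr \<tau>\<close> by a multiple of
  \<open>(1 + |z|\<^sup>2)\<^sup>m\<close>, one finds that \<open>f\<close> has no critical point over \<open>U\<close> and that every
  inverse branch \<open>g\<close> of \<open>f\<close> over \<open>U\<close> satisfies \<open>|g'| \<le> C (1 + |g|\<^sup>2)\<^sup>m\<close>. The claim is
  that \<open>s\<close> is then a regular value (\<open>polynomial_expansion_imp_regular_value\<close>).

  The only obstruction to continuing a branch \<open>g\<close> from a disc \<open>D\<close> across a boundary point \<open>a\<close>
  is that \<open>g\<close> tends to infinity at \<open>a\<close> (\<open>branch_extends_or_tends_to_infinity\<close>). The
  differential inequality makes \<open>(1 + |g|\<^sup>2)\<close> to the power \<open>-m\<close> Lipschitz, so \<open>|g|\<close> then grows at least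
  like a fixed power of \<open>1/|w - a|\<close> (\<open>asymptotic_branch_growth\<close>). Look at \<open>log g\<close> as a
  function of \<open>log (1/(w - a))\<close>, on a half-strip. It advances with a definite average speed, hence
  by Bloch's theorem covers a definite proportion of the area of the cylinder
  \<open>\<complex>/2\<pi>\<i>\<int>\<close> near its end at infinity. As inverse branches are injective, an area count bounds the number of
  such branches with pairwise disjoint images by a multiple of \<open>m\<^sup>2\<close>
  (\<open>disjoint_half_strips_bounded\<close>, \<open>disjoint_asymptotic_branches_bounded\<close>). This
  takes the place of the Denjoy--Carleman--Ahlfors theorem, and it is used twice.

  First, only finitely many \<open>a \<in> U\<close> occur, because discs at distinct points can be shrunk until
  they are disjoint. Replacing \<open>U\<close> by a small disc \<open>B(s, r)\<close>, one may assume that only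
  \<open>a = s\<close> is possible. Then \<open>f\<close> is a covering of the punctured disc
  (\<open>covering_punctured_disc\<close>), and over each of its sheets there is a lift \<open>G\<close> with
  \<open>f (G \<zeta>) = s + exp \<zeta>\<close> on the half-plane \<open>Re \<zeta> < ln r\<close>. There are three possibilities.

  \<^item> \<open>G\<close> does not tend to infinity in every direction as \<open>s + exp \<zeta>\<close> tends to \<open>s\<close>. Then the branch
    extends over \<open>s\<close>, and the component of the preimage is mapped conformally onto the disc.

  \<^item> \<open>G\<close> tends to infinity and is injective. This is a logarithmic singularity; its infinitely many
    sheets contradict the count, which is the second use (\<open>log_lift_not_injective\<close>).

  \<^item> \<open>G\<close> tends to infinity and is periodic. Then the image of \<open>G\<close> contains a neighbourhood
    of infinity, on which \<open>f\<close> is therefore bounded, so \<open>f\<close> is rational, respectively a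
    polynomial, contrary to transcendence.

  Hence the first case holds for all components, that is, \<open>s\<close> is a regular value.
\<close>

section \<open>Disjoint univalent images of half-strips\<close>

definition half_strip :: "complex set" where
  "half_strip = {z. 0 < Re z \<and> \<bar>Im z\<bar> < 1}"

lemma open_half_strip: "open half_strip"
proof -
  have eq: "half_strip = {z. 0 < Re z} \<inter> {z. Im z < 1} \<inter> {z. Im z > -1}"
    by (auto simp: half_strip_def)
  show ?thesis
    unfolding eq by (intro open_Int open_halfspace_Re_gt open_halfspace_Im_lt open_halfspace_Im_gt)
qed

lemma convex_half_strip: "convex half_strip"
proof -
  have eq: "half_strip = {z. 0 < Re z} \<inter> {z. Im z < 1} \<inter> {z. Im z > -1}"
    by (auto simp: half_strip_def)
  show ?thesis
    unfolding eq by (intro convex_Int convex_halfspace_Re_gt convex_halfspace_Im_lt convex_halfspace_Im_gt)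
qed

lemma disjoint_balls_area:
  fixes b :: "'i \<Rightarrow> complex"
  assumes "finite J" and \<rho>: "\<And>j. j \<in> J \<Longrightarrow> 0 \<le> \<rho> j"
    and disj: "disjoint_family_on (\<lambda>j. ball (b j) (\<rho> j)) J"
    and sub: "\<And>j. j \<in> J \<Longrightarrow> ball (b j) (\<rho> j) \<subseteq> cbox (Complex x0 y0) (Complex x1 y1)"
    and "x0 \<le> x1" "y0 \<le> y1"
  shows "(\<Sum>j\<in>J. pi * (\<rho> j)\<^sup>2) \<le> (x1 - x0) * (y1 - y0)"
proof -
  have "(\<Sum>j\<in>J. pi * (\<rho> j)\<^sup>2) = (\<Sum>j\<in>J. measure lebesgue (ball (b j) (\<rho> j)))"
    by (intro sum.cong refl) (simp add: content_ball \<rho> unit_ball_vol_2)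
  also have "\<dots> = measure lebesgue (\<Union>j\<in>J. ball (b j) (\<rho> j))"
    using assms(1) disj
    by (subst measure_UNION'[of J "\<lambda>j. ball (b j) (\<rho> j)"])
       (auto simp: disjoint_family_on_def pairwise_def disjnt_def)
  also have "\<dots> \<le> measure lebesgue (cbox (Complex x0 y0) (Complex x1 y1))"
    using assms(1) sub by (intro measure_mono_fmeasurable) (auto intro!: fmeasurableD fmeasurable.finite_UN)
  also have "\<dots> = (x1 - x0) * (y1 - y0)"
    using assms(5,6) content_cbox[of "Complex x0 y0" "Complex x1 y1"]
    by (simp add: Basis_complex_def inner_complex_def)
  finally show ?thesis .
qed

text \<open>
  Bloch's theorem gives a disc in the image of \<open>\<phi>\<close>. Since \<open>exp \<circ> \<phi>\<close> is injective,
  this disc cannot contain two points that differ by \<open>2\<pi>\<i>\<close>, so its radius is at most \<open>\<pi>\<close>; and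
  it may be translated by multiples of \<open>2\<pi>\<i>\<close> without changing its exponential. The translate with
  imaginary part of the centre in \<open>[0, 2\<pi>]\<close> serves as a representative on the cylinder.
\<close>
lemma ball_in_logarithmic_image:
  assumes "\<phi> holomorphic_on ball \<zeta> (1/2)" and inj: "inj_on (\<lambda>z. exp (\<phi> z)) (ball \<zeta> (1/2))"
  obtains b where "0 \<le> Im b" "Im b \<le> 2*pi" "cmod (deriv \<phi> \<zeta>) / 24 \<le> pi"
    "exp ` ball b (cmod (deriv \<phi> \<zeta>) / 24) \<subseteq> (\<lambda>z. exp (\<phi> z)) ` ball \<zeta> (1/2)"
    "Re ` ball b (cmod (deriv \<phi> \<zeta>) / 24) \<subseteq> (\<lambda>z. Re (\<phi> z)) ` ball \<zeta> (1/2)"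
proof -
  define \<rho> where "\<rho> = cmod (deriv \<phi> \<zeta>) / 24"
  obtain b0 where b0: "ball b0 \<rho> \<subseteq> \<phi> ` ball \<zeta> (1/2)"
    by (rule Bloch[OF assms(1), of \<rho>]) (auto simp: \<rho>_def)
  \<comment> \<open>Otherwise the disc contains two points with the same exponential.\<close>
  have "\<rho> \<le> pi"
  proof (rule ccontr)
    assume "\<not> \<rho> \<le> pi"
    hence "b0 + \<i> * pi \<in> ball b0 \<rho>" "b0 - \<i> * pi \<in> ball b0 \<rho>"
      by (auto simp: dist_norm norm_mult)
    with b0 have "b0 + \<i> * pi \<in> \<phi> ` ball \<zeta> (1/2)" "b0 - \<i> * pi \<in> \<phi> ` ball \<zeta> (1/2)"
      by (blast intro: subsetD)+
    then obtain p q where pq: "p \<in> ball \<zeta> (1/2)" "q \<in> ball \<zeta> (1/2)" "b0 + \<i> * pi = \<phi> p" "b0 - \<i> * pi = \<phi> q"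
      by (elim imageE)
    have "exp (\<phi> p) = exp (\<phi> q)" unfolding pq(3,4)[symmetric] by (simp add: exp_add exp_diff)
    hence "p = q" by (rule inj_onD[OF inj _ pq(1,2)])
    with pq(3,4) have "b0 + \<i> * pi = b0 - \<i> * pi" by simp
    thus False by (simp add: complex_eq_iff)
  qed
  define k where "k = \<lfloor>Im b0 / (2*pi)\<rfloor>"
  define b where "b = b0 - 2 * pi * of_int k * \<i>"
  have "of_int k \<le> Im b0 / (2*pi)" "Im b0 / (2*pi) < of_int k + 1" unfolding k_def by linarith+
  hence "of_int k * (2*pi) \<le> Im b0" "Im b0 < (of_int k + 1) * (2*pi)"
    by (simp_all add: pos_le_divide_eq pos_divide_less_eq)
  moreover have "Im b = Im b0 - of_int k * (2*pi)" by (simp add: b_def)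
  ultimately have Imb: "0 \<le> Im b" "Im b \<le> 2*pi" by (simp_all add: distrib_right)
  have shift: "\<exists>z\<in>ball \<zeta> (1/2). w + 2 * pi * of_int k * \<i> = \<phi> z" if "w \<in> ball b \<rho>" for w
  proof -
    have "w + 2 * pi * of_int k * \<i> \<in> ball b0 \<rho>"
      using that by (simp add: b_def dist_norm diff_diff_eq add.commute)
    with b0 show ?thesis by blast
  qed
  show ?thesis
  proof (rule that[of b, folded \<rho>_def, OF Imb \<open>\<rho> \<le> pi\<close>])
    show "exp ` ball b \<rho> \<subseteq> (\<lambda>z. exp (\<phi> z)) ` ball \<zeta> (1/2)"
    proof clarify
      fix w assume "w \<in> ball b \<rho>"
      then obtain z where z: "z \<in> ball \<zeta> (1/2)" "w + 2 * pi * of_int k * \<i> = \<phi> z" using shift by blast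
      have "exp (\<phi> z) = exp w"
        unfolding z(2)[symmetric] exp_eq by (intro exI[of _ k]) simp
      thus "exp w \<in> (\<lambda>z. exp (\<phi> z)) ` ball \<zeta> (1/2)" using z(1) by (rule image_eqI[OF sym])
    qed
    show "Re ` ball b \<rho> \<subseteq> (\<lambda>z. Re (\<phi> z)) ` ball \<zeta> (1/2)"
    proof clarify
      fix w assume "w \<in> ball b \<rho>"
      then obtain z where z: "z \<in> ball \<zeta> (1/2)" "w + 2 * pi * of_int k * \<i> = \<phi> z" using shift by blast
      have "Re (\<phi> z) = Re w" unfolding z(2)[symmetric] by simp
      thus "Re w \<in> (\<lambda>z. Re (\<phi> z)) ` ball \<zeta> (1/2)" using z(1) by (rule image_eqI[OF sym])
    qed
  qed
qed

lemma ball_subset_half_strip: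
  assumes "1/2 \<le> Re \<zeta>" "\<bar>Im \<zeta>\<bar> \<le> 1/2"
  shows "ball \<zeta> (1/2) \<subseteq> half_strip"
proof
  fix z assume "z \<in> ball \<zeta> (1/2)"
  hence "cmod (z - \<zeta>) < 1/2" by (simp add: dist_norm norm_minus_commute)
  hence "\<bar>Re z - Re \<zeta>\<bar> < 1/2" "\<bar>Im z - Im \<zeta>\<bar> < 1/2"
    using abs_Re_le_cmod[of "z - \<zeta>"] abs_Im_le_cmod[of "z - \<zeta>"] by auto
  with assms have "0 < Re z" "\<bar>Im z\<bar> < 1" by linarith+
  thus "z \<in> half_strip" by (simp add: half_strip_def)
qed

text \<open>
  The bound \<open>\<pi>\<close> for Bloch discs bounds the derivative of \<open>\<phi>\<close>, so the real part, the height on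
  the cylinder, grows at most linearly along the strip. This confines the Bloch discs of
  a long piece of the strip to a piece of the cylinder of comparable length.
\<close>
lemma logarithm_variation_bound:
  assumes hol: "\<phi> holomorphic_on half_strip" and inj: "inj_on (\<lambda>z. exp (\<phi> z)) half_strip"
    and z: "1/2 \<le> Re z" "\<bar>Im z\<bar> \<le> 1/2" "Re z \<le> R"
  shows "\<bar>Re (\<phi> z) - Re (\<phi> 1)\<bar> \<le> 24 * pi * (R + 1)"
proof -
  define S where "S = cbox (Complex (1/2) (-1/2)) (Complex (max R 1) (1/2))"
  have S_iff: "w \<in> S \<longleftrightarrow> 1/2 \<le> Re w \<and> \<bar>Im w\<bar> \<le> 1/2 \<and> Re w \<le> max R 1" for w
    unfolding S_def in_cbox_complex_iff by (simp add: abs_le_iff) linarith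
  have S: "1/2 \<le> Re w" "\<bar>Im w\<bar> \<le> 1/2" if "w \<in> S" for w
    using that by (simp_all only: S_iff)
  have lip: "cmod (\<phi> z - \<phi> 1) \<le> 24 * pi * cmod (z - 1)"
  proof (rule field_differentiable_bound)
    show "convex S" by (simp add: S_def)
    fix w assume w: "w \<in> S"
    have sub: "ball w (1/2) \<subseteq> half_strip" using S[OF w] by (rule ball_subset_half_strip)
    show "(\<phi> has_field_derivative deriv \<phi> w) (at w within S)"
    proof (rule has_field_derivative_at_within, rule holomorphic_derivI[OF hol open_half_strip])
      show "w \<in> half_strip" using sub by auto
    qed
    show "cmod (deriv \<phi> w) \<le> 24 * pi"
    proof (rule ball_in_logarithmic_image[of \<phi> w])
      show "\<phi> holomorphic_on ball w (1/2)" using hol sub by (rule holomorphic_on_subset)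
      show "inj_on (\<lambda>z. exp (\<phi> z)) (ball w (1/2))" using inj sub by (rule inj_on_subset)
    qed simp
  next
    show "z \<in> S" using z by (simp add: S_iff)
    show "1 \<in> S" by (simp add: S_iff)
  qed
  have "cmod (z - 1) \<le> \<bar>Re z - 1\<bar> + \<bar>Im z\<bar>" using cmod_le[of "z - 1"] by simp
  also have "\<bar>Re z - 1\<bar> + \<bar>Im z\<bar> \<le> R + 1" using z by linarith
  finally have "24 * pi * cmod (z - 1) \<le> 24 * pi * (R + 1)" by (rule mult_left_mono) simp
  with lip have "cmod (\<phi> z - \<phi> 1) \<le> 24 * pi * (R + 1)" by (rule order_trans)
  moreover have "\<bar>Re (\<phi> z) - Re (\<phi> 1)\<bar> \<le> cmod (\<phi> z - \<phi> 1)"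
    using abs_Re_le_cmod[of "\<phi> z - \<phi> 1"] by simp
  ultimately show ?thesis by (rule order_trans[rotated])
qed

text \<open>
  The points \<open>n + 1 + t\<close> have disjoint neighbourhoods of radius \<open>1/2\<close>, so the Bloch discs
  at these points, taken for all \<open>\<phi> i\<close> together, have disjoint images on the cylinder. The sum below is,
  up to a factor, their total area.
\<close>
lemma logarithm_derivative_square_sum:
  assumes "finite I"
    and hol: "\<And>i. i \<in> I \<Longrightarrow> \<phi> i holomorphic_on half_strip"
    and inj: "\<And>i. i \<in> I \<Longrightarrow> inj_on (\<lambda>z. exp (\<phi> i z)) half_strip"
    and disj: "disjoint_family_on (\<lambda>i. (\<lambda>z. exp (\<phi> i z)) ` half_strip) I"
    and base: "\<And>i. i \<in> I \<Longrightarrow> \<bar>Re (\<phi> i 1)\<bar> \<le> B"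
    and t: "0 \<le> t" "t \<le> 1" and "0 \<le> B"
  shows "(\<Sum>i\<in>I. \<Sum>n<X. (cmod (deriv (\<phi> i) (of_real (real n + 1 + t))))\<^sup>2)
           \<le> 4608 * (B + 24 * pi * (real X + 3))"
proof -
  define p where "p n = complex_of_real (real n + 1 + t)" for n :: nat
  define J where "J = I \<times> {..<X}"
  define \<rho> where "\<rho> j = cmod (deriv (\<phi> (fst j)) (p (snd j))) / 24" for j
  \<comment> \<open>Heights on the cylinder stay in \<open>[-M, M]\<close>: the discs lie over \<open>Re \<le> X + 2\<close>, and \<open>B\<close> bounds the start.\<close>
  define M where "M = B + 24 * pi * (real X + 3)"
  have sub: "ball (p n) (1/2) \<subseteq> half_strip" for n
    using t by (intro ball_subset_half_strip) (auto simp: p_def)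
  define P where "P j b \<longleftrightarrow> 0 \<le> Im b \<and> Im b \<le> 2*pi \<and> \<rho> j \<le> pi \<and>
     exp ` ball b (\<rho> j) \<subseteq> (\<lambda>z. exp (\<phi> (fst j) z)) ` ball (p (snd j)) (1/2) \<and>
     Re ` ball b (\<rho> j) \<subseteq> (\<lambda>z. Re (\<phi> (fst j) z)) ` ball (p (snd j)) (1/2)" for j b
  have "\<exists>b. P j b" if "j \<in> J" for j
  proof -
    have "fst j \<in> I" using that by (auto simp: J_def)
    have "\<phi> (fst j) holomorphic_on ball (p (snd j)) (1/2)"
      using holomorphic_on_subset[OF hol[OF \<open>fst j \<in> I\<close>] sub] .
    moreover have "inj_on (\<lambda>z. exp (\<phi> (fst j) z)) (ball (p (snd j)) (1/2))"
      using inj_on_subset[OF inj[OF \<open>fst j \<in> I\<close>] sub] .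
    ultimately have this: "\<phi> (fst j) holomorphic_on ball (p (snd j)) (1/2)"
      "inj_on (\<lambda>z. exp (\<phi> (fst j) z)) (ball (p (snd j)) (1/2))" .
    from ball_in_logarithmic_image[OF this] show ?thesis
      unfolding P_def \<rho>_def by metis
  qed
  then obtain b where "\<And>j. j \<in> J \<Longrightarrow> P j (b j)" by metis
  note b = this[unfolded P_def]
  have area: "(\<Sum>j\<in>J. pi * (\<rho> j)\<^sup>2) \<le> (M - - M) * (3 * pi - - pi)"
  proof (rule disjoint_balls_area[where b = b])
    show "finite J" using assms(1) by (simp add: J_def)
    show "0 \<le> \<rho> j" if "j \<in> J" for j by (simp add: \<rho>_def)
    have "0 \<le> M" using \<open>0 \<le> B\<close> by (simp add: M_def)
    thus "- M \<le> M" by simp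
    show "- pi \<le> 3 * pi" using pi_gt_zero by linarith
    show "disjoint_family_on (\<lambda>j. ball (b j) (\<rho> j)) J"
      unfolding disjoint_family_on_def
    proof (intro ballI impI)
      fix j k assume jk: "j \<in> J" "k \<in> J" "j \<noteq> k"
      show "ball (b j) (\<rho> j) \<inter> ball (b k) (\<rho> k) = {}"
      proof (rule ccontr)
        assume "ball (b j) (\<rho> j) \<inter> ball (b k) (\<rho> k) \<noteq> {}"
        then obtain w where w: "w \<in> ball (b j) (\<rho> j)" "w \<in> ball (b k) (\<rho> k)" by blast
        have "exp w \<in> (\<lambda>z. exp (\<phi> (fst j) z)) ` ball (p (snd j)) (1/2)"
          using b[OF jk(1)] w(1) by (meson imageI subsetD)
        then obtain x where x: "x \<in> ball (p (snd j)) (1/2)" "exp w = exp (\<phi> (fst j) x)" by (rule imageE)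
        have "exp w \<in> (\<lambda>z. exp (\<phi> (fst k) z)) ` ball (p (snd k)) (1/2)"
          using b[OF jk(2)] w(2) by (meson imageI subsetD)
        then obtain y where y: "y \<in> ball (p (snd k)) (1/2)" "exp w = exp (\<phi> (fst k) y)" by (rule imageE)
        have xy: "x \<in> half_strip" "y \<in> half_strip" using subsetD[OF sub x(1)] subsetD[OF sub y(1)] .
        have I: "fst j \<in> I" "fst k \<in> I" using jk by (auto simp: J_def)
        have eq: "fst j = fst k"
        proof (rule ccontr)
          assume "fst j \<noteq> fst k"
          with disj I have "(\<lambda>z. exp (\<phi> (fst j) z)) ` half_strip \<inter> (\<lambda>z. exp (\<phi> (fst k) z)) ` half_strip = {}"
            by (rule disjoint_family_onD)
          thus False using x(2) y(2) xy by blast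
        qed
        have "exp (\<phi> (fst j) x) = exp (\<phi> (fst j) y)" by (metis eq x(2) y(2))
        hence "x = y" by (rule inj_onD[OF inj[OF I(1)] _ xy])
        have "snd j \<noteq> snd k" using eq jk(3) prod_eqI by blast
        hence "1 \<le> \<bar>real (snd j) - real (snd k)\<bar>" by linarith
        also have "\<dots> = dist (p (snd j)) (p (snd k))"
          unfolding p_def dist_norm of_real_diff[symmetric] norm_of_real by simp
        also have "\<dots> < 1"
        proof (rule dist_triangle_half_l)
          show "dist (p (snd j)) x < 1/2" using x(1) by simp
          show "dist (p (snd k)) x < 1/2" using y(1) unfolding \<open>x = y\<close> by simp
        qed
        finally show False by simp
      qed
    qed
    show "ball (b j) (\<rho> j) \<subseteq> cbox (Complex (-M) (-pi)) (Complex M (3*pi))" if "j \<in> J" for j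
    proof
      fix w assume w: "w \<in> ball (b j) (\<rho> j)"
      have I: "fst j \<in> I" "snd j < X" using that by (auto simp: J_def)
      have "\<bar>Im w - Im (b j)\<bar> \<le> cmod (w - b j)" using abs_Im_le_cmod[of "w - b j"] by simp
      also have "\<dots> \<le> pi" using w b[OF that] by (auto simp: dist_norm norm_minus_commute)
      finally have im: "- pi \<le> Im w" "Im w \<le> 3*pi" using b[OF that] by auto
      have "Re w \<in> (\<lambda>z. Re (\<phi> (fst j) z)) ` ball (p (snd j)) (1/2)"
        using b[OF that] w by (meson imageI subsetD)
      then obtain z where z: "z \<in> ball (p (snd j)) (1/2)" "Re w = Re (\<phi> (fst j) z)" by (rule imageE)
      have "cmod (z - p (snd j)) < 1/2" using z(1) by (simp add: dist_norm norm_minus_commute)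
      hence "\<bar>Re z - (real (snd j) + 1 + t)\<bar> < 1/2" "\<bar>Im z\<bar> < 1/2"
        using abs_Re_le_cmod[of "z - p (snd j)"] abs_Im_le_cmod[of "z - p (snd j)"] by (auto simp: p_def)
      hence "1/2 \<le> Re z" "\<bar>Im z\<bar> \<le> 1/2" "Re z \<le> real X + 2"
        using t I(2) by linarith+
      from logarithm_variation_bound[OF hol[OF I(1)] inj[OF I(1)] this]
      have "\<bar>Re (\<phi> (fst j) z)\<bar> \<le> M" using base[OF I(1)] by (simp add: M_def algebra_simps)
      thus "w \<in> cbox (Complex (-M) (-pi)) (Complex M (3*pi))"
        using im z(2) by (simp add: in_cbox_complex_iff abs_le_iff)
    qed
  qed
  have sq: "(\<Sum>i\<in>I. \<Sum>n<X. (cmod (deriv (\<phi> i) (p n)))\<^sup>2) = 576 * (\<Sum>j\<in>J. (\<rho> j)\<^sup>2)"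
    unfolding sum.cartesian_product sum_distrib_left J_def
    by (intro sum.cong) (auto simp: \<rho>_def power_divide)
  have "pi * (\<Sum>j\<in>J. (\<rho> j)\<^sup>2) \<le> pi * (8 * M)"
    using area by (simp add: sum_distrib_left mult_ac)
  hence "(\<Sum>j\<in>J. (\<rho> j)\<^sup>2) \<le> 8 * M"
    by (rule mult_left_le_imp_le) simp
  hence "(\<Sum>i\<in>I. \<Sum>n<X. (cmod (deriv (\<phi> i) (p n)))\<^sup>2) \<le> 4608 * M"
    unfolding sq by simp
  thus ?thesis unfolding M_def p_def .
qed

text \<open>
  The growth hypothesis says that \<open>\<phi> i = ln (G i)\<close> has average speed at least \<open>1/K\<close> along the
  real axis. By the mean value theorem, applied to the sum over \<open>n\<close> of \<open>Re (\<phi> i (n + 1 + t))\<close> as a function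
  of the offset \<open>t\<close>, some offset realises this average for all \<open>i\<close> at once. Then the sum of the squares
  of the speeds over \<open>n < X\<close> is at least about \<open>card I * X / K\<^sup>2\<close>, while by the area bound it is at most
  a constant times \<open>X\<close>. Letting \<open>X\<close> tend to infinity gives the claim.
\<close>
lemma disjoint_half_strips_bounded:
  fixes G :: "'i \<Rightarrow> complex \<Rightarrow> complex" and K :: nat
  assumes "finite I" and "0 < K"
    and hol: "\<And>i. i \<in> I \<Longrightarrow> G i holomorphic_on half_strip"
    and inj: "\<And>i. i \<in> I \<Longrightarrow> inj_on (G i) half_strip"
    and disj: "disjoint_family_on (\<lambda>i. G i ` half_strip) I"
    and c: "\<And>i. i \<in> I \<Longrightarrow> 0 < c i"
    and grow: "\<And>i z. i \<in> I \<Longrightarrow> z \<in> half_strip \<Longrightarrow> c i * exp (Re z) \<le> cmod (G i z) ^ K"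
  shows "real (card I) \<le> 110592 * pi * (real K)\<^sup>2"
proof -
  have "\<exists>\<phi>. \<phi> holomorphic_on half_strip \<and> (\<forall>z\<in>half_strip. G i z = exp (\<phi> z))" if "i \<in> I" for i
  proof -
    have "G i z \<noteq> 0" if "z \<in> half_strip" for z
    proof
      assume "G i z = 0"
      with grow[OF \<open>i \<in> I\<close> that] \<open>0 < K\<close> have "c i * exp (Re z) \<le> 0" by (simp add: power_0_left)
      with c[OF \<open>i \<in> I\<close>] show False by (simp add: mult_le_0_iff)
    qed
    then obtain g where "g holomorphic_on half_strip" "\<And>z. z \<in> half_strip \<Longrightarrow> G i z = exp (g z)"
      using contractible_imp_holomorphic_log[OF hol[OF \<open>i \<in> I\<close>] convex_imp_contractible[OF convex_half_strip]]
      by metis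
    thus ?thesis by blast
  qed
  then obtain \<phi> where \<phi>: "\<And>i. i \<in> I \<Longrightarrow> \<phi> i holomorphic_on half_strip"
    "\<And>i z. i \<in> I \<Longrightarrow> z \<in> half_strip \<Longrightarrow> G i z = exp (\<phi> i z)" by metis
  have inj': "inj_on (\<lambda>z. exp (\<phi> i z)) half_strip" if "i \<in> I" for i
    using inj[OF that] \<phi>(2)[OF that] by (subst inj_on_cong[of _ _ "G i"]) auto
  have img: "(\<lambda>z. exp (\<phi> i z)) ` half_strip = G i ` half_strip" if "i \<in> I" for i
    using \<phi>(2)[OF that] by auto
  have disj': "disjoint_family_on (\<lambda>i. (\<lambda>z. exp (\<phi> i z)) ` half_strip) I"
    using disj img by (auto simp: disjoint_family_on_def)
  define B where "B = (\<Sum>i\<in>I. \<bar>Re (\<phi> i 1)\<bar>)"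
  have B: "\<bar>Re (\<phi> i 1)\<bar> \<le> B" if "i \<in> I" for i
    unfolding B_def using that assms(1) by (intro member_le_sum) auto
  have "0 \<le> B" by (auto simp: B_def intro: sum_nonneg)
  define N where "N = real (card I)"
  define L where "L = (\<Sum>i\<in>I. ln (c i) / K - Re (\<phi> i 1))"
  have key: "N * real X / (real K)\<^sup>2 + 2 * L / K \<le> 4608 * (B + 24 * pi * (real X + 3))" for X :: nat
  proof -
    \<comment> \<open>Moving the offset from \<open>0\<close> to \<open>1\<close> telescopes to the total advance of all \<open>\<phi> i\<close>.\<close>
    define \<Psi> where "\<Psi> t = (\<Sum>i\<in>I. \<Sum>n<X. Re (\<phi> i (of_real (real n + 1 + t))))" for t
    define d where "d i n t = deriv (\<phi> i) (of_real (real n + 1 + t))" for i n t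
    have "\<exists>t. 0 < t \<and> t < (1::real) \<and> \<Psi> 1 - \<Psi> 0 = (1 - 0) * (\<Sum>i\<in>I. \<Sum>n<X. Re (d i n t))"
    proof (rule MVT2)
      fix t :: real assume t: "0 \<le> t" "t \<le> 1"
      have "((\<lambda>t. Re (\<phi> i (of_real (real n + 1 + t)))) has_real_derivative Re (d i n t)) (at t)"
        if "i \<in> I" for i n
      proof -
        have "complex_of_real (real n + 1 + t) \<in> half_strip" using t by (simp add: half_strip_def)
        hence "(\<phi> i has_field_derivative d i n t) (at (complex_of_real (real n + 1 + t)))"
          unfolding d_def by (intro holomorphic_derivI[OF \<phi>(1)[OF that] open_half_strip])
        moreover have "((\<lambda>t. complex_of_real (real n + 1 + t)) has_vector_derivative 1) (at t)"
          by (auto intro!: derivative_eq_intros)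
        ultimately have "((\<phi> i \<circ> (\<lambda>t. complex_of_real (real n + 1 + t))) has_vector_derivative 1 * d i n t) (at t)"
          by (intro field_vector_diff_chain_at) simp_all
        hence "((\<lambda>t. \<phi> i (complex_of_real (real n + 1 + t))) has_vector_derivative d i n t) (at t)"
          by (simp add: o_def)
        from bounded_linear.has_vector_derivative[OF bounded_linear_Re this] show ?thesis
          by (simp add: has_real_derivative_iff_has_vector_derivative)
      qed
      thus "(\<Psi> has_real_derivative (\<Sum>i\<in>I. \<Sum>n<X. Re (d i n t))) (at t)"
        unfolding \<Psi>_def by (auto intro!: DERIV_sum)
    qed simp
    then obtain t where "0 < t" "t < 1" and
      mvt: "\<Psi> 1 - \<Psi> 0 = (\<Sum>i\<in>I. \<Sum>n<X. Re (d i n t))" by auto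
    hence t: "0 \<le> t" "t \<le> 1" by simp_all
    have tele: "\<Psi> 1 - \<Psi> 0 = (\<Sum>i\<in>I. Re (\<phi> i (of_real (real X + 1))) - Re (\<phi> i 1))"
    proof -
      have "\<Psi> 1 - \<Psi> 0 = (\<Sum>i\<in>I. \<Sum>n<X. Re (\<phi> i (of_real (real (Suc n) + 1))) - Re (\<phi> i (of_real (real n + 1))))"
        by (simp add: \<Psi>_def sum_subtractf add_ac)
      also have "\<dots> = (\<Sum>i\<in>I. Re (\<phi> i (of_real (real X + 1))) - Re (\<phi> i 1))"
      proof (rule sum.cong[OF refl])
        fix i
        show "(\<Sum>n<X. Re (\<phi> i (of_real (real (Suc n) + 1))) - Re (\<phi> i (of_real (real n + 1))))
            = Re (\<phi> i (of_real (real X + 1))) - Re (\<phi> i 1)"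
          using sum_lessThan_telescope[of "\<lambda>n. Re (\<phi> i (of_real (real n + 1)))" X] by simp
      qed
      finally show ?thesis .
    qed
    have "(\<Sum>i\<in>I. real X / K + (ln (c i) / K - Re (\<phi> i 1))) \<le>
        (\<Sum>i\<in>I. Re (\<phi> i (of_real (real X + 1))) - Re (\<phi> i 1))"
    proof (rule sum_mono)
      fix i assume i: "i \<in> I"
      define z where "z = complex_of_real (real X + 1)"
      have z: "z \<in> half_strip" by (simp add: z_def half_strip_def)
      have "c i * exp (real X + 1) = exp (ln (c i) + (real X + 1))"
        using c[OF i] by (simp add: exp_add)
      moreover have "cmod (G i z) ^ K = exp (K * Re (\<phi> i z))"
        using \<phi>(2)[OF i z] by (simp add: exp_of_nat_mult)
      moreover have "c i * exp (real X + 1) \<le> cmod (G i z) ^ K"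
        using grow[OF i z] by (simp add: z_def)
      ultimately have "ln (c i) + (real X + 1) \<le> K * Re (\<phi> i z)" by simp
      hence "(real X + ln (c i)) / K \<le> Re (\<phi> i z)"
        using \<open>0 < K\<close> by (simp add: field_simps)
      thus "real X / K + (ln (c i) / K - Re (\<phi> i 1)) \<le> Re (\<phi> i (of_real (real X + 1))) - Re (\<phi> i 1)"
        by (simp add: z_def add_divide_distrib)
    qed
    hence lower: "N * real X / K + L \<le> (\<Sum>i\<in>I. \<Sum>n<X. Re (d i n t))"
      unfolding tele[symmetric] mvt by (simp add: sum.distrib N_def L_def)
    \<comment> \<open>Cauchy--Schwarz in linear form: \<open>x\<^sup>2 \<ge> 2x/K - 1/K\<^sup>2\<close>.\<close>
    have amgm: "(\<Sum>i\<in>I. \<Sum>n<X. 2 / K * Re (d i n t) - 1 / (real K)\<^sup>2) \<le> (\<Sum>i\<in>I. \<Sum>n<X. (cmod (d i n t))\<^sup>2)"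
    proof (intro sum_mono)
      fix i n
      have "2 / K * cmod (d i n t) - 1 / (real K)\<^sup>2 \<le> (cmod (d i n t))\<^sup>2"
        using zero_le_power2[of "cmod (d i n t) - 1 / K"] by (simp add: power2_diff power_divide)
      moreover have "2 / K * Re (d i n t) \<le> 2 / K * cmod (d i n t)"
        by (intro mult_left_mono complex_Re_le_cmod) auto
      ultimately show "2 / K * Re (d i n t) - 1 / (real K)\<^sup>2 \<le> (cmod (d i n t))\<^sup>2" by linarith
    qed
    have "(\<Sum>i\<in>I. \<Sum>n<X. (cmod (d i n t))\<^sup>2) \<le> 4608 * (B + 24 * pi * (real X + 3))"
      unfolding d_def
      by (rule logarithm_derivative_square_sum[where \<phi> = \<phi> and I = I, OF assms(1) \<phi>(1) inj' disj' B t \<open>0 \<le> B\<close>])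
    with amgm have "(\<Sum>i\<in>I. \<Sum>n<X. 2 / K * Re (d i n t) - 1 / (real K)\<^sup>2)
       \<le> 4608 * (B + 24 * pi * (real X + 3))" by (rule order_trans)
    moreover have "(\<Sum>i\<in>I. \<Sum>n<X. 2 / K * Re (d i n t) - 1 / (real K)\<^sup>2)
         = 2 / K * (\<Sum>i\<in>I. \<Sum>n<X. Re (d i n t)) - N * X / (real K)\<^sup>2"
      by (simp add: sum_subtractf sum_distrib_left N_def)
    moreover have "2 / K * (N * real X / K + L) \<le> 2 / K * (\<Sum>i\<in>I. \<Sum>n<X. Re (d i n t))"
      using lower by (rule mult_left_mono) simp
    moreover have "2 / K * (N * real X / K + L) = 2 * (N * real X / (real K)\<^sup>2) + 2 * L / K"
      by (simp add: power2_eq_square distrib_left)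
    ultimately show ?thesis by linarith
  qed
  have "N / (real K)\<^sup>2 \<le> 110592 * pi"
  proof (rule ccontr)
    assume "\<not> ?thesis"
    hence pos: "0 < N / (real K)\<^sup>2 - 110592 * pi" by simp
    obtain X :: nat where X: "(4608 * (B + 72 * pi) - 2 * L / K) / (N / (real K)\<^sup>2 - 110592 * pi) < real X"
      using reals_Archimedean2 by blast
    hence "4608 * (B + 72 * pi) - 2 * L / K < real X * (N / (real K)\<^sup>2 - 110592 * pi)"
      using pos by (simp add: pos_divide_less_eq)
    with key[of X] show False by (simp add: algebra_simps)
  qed
  thus ?thesis using \<open>0 < K\<close> by (simp add: N_def field_simps)
qed

section \<open>Inverse branches and their continuation\<close>

text \<open>
  A pole is excluded explicitly because the value of \<open>f\<close> there is only a placeholder for infinity.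
\<close>
definition inverse_branch :: "(complex \<Rightarrow> complex) \<Rightarrow> complex set \<Rightarrow> (complex \<Rightarrow> complex) \<Rightarrow> bool" where
  "inverse_branch f D g \<longleftrightarrow> g holomorphic_on D \<and> (\<forall>w\<in>D. \<not> is_pole f (g w) \<and> f (g w) = w)"

text \<open>
  In classical terms \<open>a\<close> is an asymptotic value, and the image under \<open>g\<close> of the radius of the disc that ends
  at \<open>a\<close> is an asymptotic path.
\<close>
definition asymptotic_branch ::
    "(complex \<Rightarrow> complex) \<Rightarrow> complex \<Rightarrow> real \<Rightarrow> complex \<Rightarrow> (complex \<Rightarrow> complex) \<Rightarrow> bool" where
  "asymptotic_branch f w \<rho> a g \<longleftrightarrow> 0 < \<rho> \<and> dist w a = \<rho> \<and> inverse_branch f (ball w \<rho>) g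
     \<and> filterlim g at_infinity (at a within ball w \<rho>)"

definition asymptotic_points :: "(complex \<Rightarrow> complex) \<Rightarrow> complex set \<Rightarrow> complex set" where
  "asymptotic_points f B = {a \<in> B. \<exists>w \<rho> g. ball w \<rho> \<subseteq> B \<and> asymptotic_branch f w \<rho> a g}"

lemma asymptotic_points_mono: "A \<subseteq> B \<Longrightarrow> asymptotic_points f A \<subseteq> asymptotic_points f B"
  unfolding asymptotic_points_def by blast

text \<open>
  Used to see that the overlap of two local extensions reaches into the disc on which both
  agree with the given branch.
\<close>
lemma meeting_balls_meet_center_ball:
  fixes w :: "'a::euclidean_space"
  assumes "0 < \<rho>" and ab: "a \<in> cball w \<rho>" "b \<in> cball w \<rho>" and ne: "ball a r \<inter> ball b s \<noteq> {}"
  shows "ball a r \<inter> ball b s \<inter> ball w \<rho> \<noteq> {}"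
proof -
  obtain x where x: "dist a x < r" "dist b x < s" using ne by auto
  hence rs: "0 < r" "0 < s" "dist a b < r + s"
    using zero_le_dist[of a x] zero_le_dist[of b x] dist_triangle2[of a b x] by linarith+
  define t where "t = r / (r + s)"
  define p where "p = a + t *\<^sub>R (b - a)"
  have t: "0 \<le> t" "t \<le> 1" "1 - t = s / (r + s)" using rs by (simp_all add: t_def divide_simps)
  have ap: "dist a p = t * dist a b"
    using t by (simp add: p_def dist_norm norm_minus_commute)
  have "b - p = (1 - t) *\<^sub>R (b - a)" by (simp add: p_def algebra_simps)
  hence "norm (b - p) = (1 - t) * norm (b - a)" using t(2) by (simp only: norm_scaleR abs_of_nonneg diff_ge_0_iff_ge)
  hence bp: "dist b p = (1 - t) * dist a b" by (simp add: dist_norm norm_minus_commute)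
  have quo: "dist a b / (r + s) < 1" using rs by simp
  have "dist a p < r" using mult_strict_left_mono[OF quo rs(1)] by (simp add: ap t_def)
  moreover have "dist b p < s" using mult_strict_left_mono[OF quo rs(2)] by (simp add: bp t(3))
  ultimately have p: "p \<in> ball a r \<inter> ball b s" by simp
  have "(1 - t) *\<^sub>R a + t *\<^sub>R b \<in> cball w \<rho>"
    by (rule convexD_alt[OF convex_cball ab t(1,2)])
  moreover have "p = (1 - t) *\<^sub>R a + t *\<^sub>R b" by (simp add: p_def algebra_simps)
  ultimately have "p \<in> closure (ball w \<rho>)" using \<open>0 < \<rho>\<close> by simp
  hence "ball a r \<inter> ball b s \<inter> closure (ball w \<rho>) \<noteq> {}" using p by blast
  moreover have "open (ball a r \<inter> ball b s)" by (intro open_Int open_ball)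
  ultimately show ?thesis using open_Int_closure_eq_empty by blast
qed

lemma ball_subset_UN_balls:
  fixes w :: "'a::real_normed_vector"
  assumes "0 < \<rho>" "0 < \<delta>"
  shows "ball w (\<rho> + \<delta>) \<subseteq> (\<Union>x\<in>cball w \<rho>. ball x \<delta>)"
proof
  fix x assume x: "x \<in> ball w (\<rho> + \<delta>)"
  show "x \<in> (\<Union>x\<in>cball w \<rho>. ball x \<delta>)"
  proof (cases "x \<in> cball w \<rho>")
    case True
    moreover have "x \<in> ball x \<delta>" using assms(2) by simp
    ultimately show ?thesis by (rule UN_I)
  next
    case False
    hence d: "\<rho> < norm (x - w)" by (simp add: dist_norm norm_minus_commute)
    define t where "t = \<rho> / norm (x - w)"
    define p where "p = w + t *\<^sub>R (x - w)"
    have pos: "0 < norm (x - w)" using d assms(1) by linarith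
    have t: "0 \<le> t" "t \<le> 1" "t * norm (x - w) = \<rho>"
      using d assms(1) pos by (simp_all add: t_def divide_le_eq)
    have "dist w p = \<rho>" using t by (simp add: p_def dist_norm)
    hence "p \<in> cball w \<rho>" by simp
    moreover have "p - x = (t - 1) *\<^sub>R (x - w)" by (simp add: p_def algebra_simps)
    hence "dist p x = (1 - t) * norm (x - w)" using t by (simp add: dist_norm)
    hence "dist p x = norm (x - w) - \<rho>" using t(3) by (simp add: left_diff_distrib)
    hence "x \<in> ball p \<delta>" using x by (simp add: dist_norm norm_minus_commute)
    ultimately show ?thesis by (rule UN_I)
  qed
qed

lemma inverse_branchD:
  assumes "inverse_branch f D g"
  shows "g holomorphic_on D" "continuous_on D g" "\<And>w. w \<in> D \<Longrightarrow> \<not> is_pole f (g w)"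
    "\<And>w. w \<in> D \<Longrightarrow> f (g w) = w"
proof -
  show "g holomorphic_on D" using assms by (simp add: inverse_branch_def)
  thus "continuous_on D g" by (rule holomorphic_on_imp_continuous_on)
qed (use assms in \<open>simp_all add: inverse_branch_def\<close>)

lemma inverse_branch_subset: "inverse_branch f D g \<Longrightarrow> E \<subseteq> D \<Longrightarrow> inverse_branch f E g"
  unfolding inverse_branch_def by (meson holomorphic_on_subset subsetD)

lemma inverse_branch_cong:
  assumes "inverse_branch f D g" "\<And>w. w \<in> D \<Longrightarrow> h w = g w"
  shows "inverse_branch f D h"
  using assms holomorphic_transform[of g D h] by (simp add: inverse_branch_def)

lemma inverse_branch_in_preimage:
  "inverse_branch f D g \<Longrightarrow> D \<subseteq> B \<Longrightarrow> w \<in> D \<Longrightarrow> g w \<in> finite_preimage f B"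
  by (auto simp: inverse_branch_def finite_preimage_def)

lemma inverse_branch_inj: "inverse_branch f D g \<Longrightarrow> inj_on g D"
  by (rule inj_on_inverseI[where g = f]) (rule inverse_branchD(4))

lemma inverse_branch_UN:
  assumes br: "\<And>i. i \<in> I \<Longrightarrow> inverse_branch f (U i) (g i)" and op: "\<And>i. i \<in> I \<Longrightarrow> open (U i)"
    and agree: "\<And>i j x. i \<in> I \<Longrightarrow> j \<in> I \<Longrightarrow> x \<in> U i \<Longrightarrow> x \<in> U j \<Longrightarrow> g i x = g j x"
  obtains G where "inverse_branch f (\<Union>i\<in>I. U i) G" "\<And>i x. i \<in> I \<Longrightarrow> x \<in> U i \<Longrightarrow> G x = g i x"
proof -
  define G where "G x = g (SOME i. i \<in> I \<and> x \<in> U i) x" for x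
  have G: "G x = g i x" if "i \<in> I" "x \<in> U i" for i x
  proof -
    have "(SOME i. i \<in> I \<and> x \<in> U i) \<in> I \<and> x \<in> U (SOME i. i \<in> I \<and> x \<in> U i)"
      using that by (intro someI[of "\<lambda>i. i \<in> I \<and> x \<in> U i" i]) simp
    thus ?thesis unfolding G_def using agree that by blast
  qed
  have "inverse_branch f (U i) G" if "i \<in> I" for i
    using br[OF that] G[OF that] by (rule inverse_branch_cong)
  hence "inverse_branch f (\<Union>i\<in>I. U i) G"
    using op holomorphic_on_UN_open[of I G U] unfolding inverse_branch_def by (metis UN_E)
  with G show ?thesis using that by blast
qed

locale noncritical_over =
  fixes f :: "complex \<Rightarrow> complex" and B :: "complex set"
  assumes mero: "f nicely_meromorphic_on UNIV" and open_B: "open B"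
    and deriv_nz: "\<And>z. z \<in> finite_preimage f B \<Longrightarrow> deriv f z \<noteq> 0"
begin

lemma analytic_off_poles: "\<not> is_pole f z \<Longrightarrow> f analytic_on {z}"
  using nicely_meromorphic_on_imp_analytic_at[OF mero] by simp

lemma open_nonpoles: "open {z. \<not> is_pole f z}"
proof (rule openI)
  fix z assume "z \<in> {z. \<not> is_pole f z}"
  hence "f analytic_on {z}" using analytic_off_poles by simp
  then obtain e where e: "e > 0" "f holomorphic_on ball z e" by (auto simp: analytic_at_ball)
  have "\<not> is_pole f x" if "x \<in> ball z e" for x
    using e(2) that not_is_pole_holomorphic[of "ball z e" x f] by simp
  thus "\<exists>e>0. ball z e \<subseteq> {z. \<not> is_pole f z}" using e(1) by auto
qed

lemma holomorphic_off_poles: "f holomorphic_on {z. \<not> is_pole f z}"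
proof (rule analytic_imp_holomorphic)
  show "f analytic_on {z. \<not> is_pole f z}"
    using analytic_off_poles by (subst analytic_on_analytic_at) blast
qed

lemma open_finite_preimage: "open V \<Longrightarrow> open (finite_preimage f V)"
  using continuous_open_preimage[OF holomorphic_on_imp_continuous_on[OF holomorphic_off_poles] open_nonpoles, of V]
  unfolding finite_preimage_def vimage_def Collect_conj_eq .

lemma local_branch:
  assumes z: "z \<in> finite_preimage f B"
  obtains N \<epsilon> h where "open N" "z \<in> N" "N \<subseteq> finite_preimage f B" "inj_on f N" "0 < \<epsilon>"
    "ball (f z) \<epsilon> \<subseteq> B" "inverse_branch f (ball (f z) \<epsilon>) h" "\<And>x. x \<in> N \<Longrightarrow> h (f x) = x"
proof -
  let ?P = "finite_preimage f B"
  have hol: "f holomorphic_on ?P"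
    using holomorphic_off_poles by (rule holomorphic_on_subset) (auto simp: finite_preimage_def)
  obtain r where r: "r > 0" "ball z r \<subseteq> ?P" "open (f ` ball z r)" "inj_on f (ball z r)"
    using has_complex_derivative_locally_invertible[OF hol z open_finite_preimage[OF open_B] deriv_nz[OF z]] .
  obtain h where h: "h holomorphic_on f ` ball z r" "\<And>x. x \<in> ball z r \<Longrightarrow> h (f x) = x"
    using holomorphic_has_inverse[OF holomorphic_on_subset[OF hol r(2)] open_ball r(4)] by metis
  have "open (f ` ball z r \<inter> B)" "f z \<in> f ` ball z r \<inter> B"
    using r open_B z by (auto simp: finite_preimage_def)
  then obtain \<epsilon> where \<epsilon>: "\<epsilon> > 0" "ball (f z) \<epsilon> \<subseteq> f ` ball z r \<inter> B"
    by (meson open_contains_ball)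
  define N where "N = ball z r \<inter> finite_preimage f (ball (f z) \<epsilon>)"
  show ?thesis
  proof (rule that[of N \<epsilon> h])
    show "open N" unfolding N_def by (intro open_Int open_ball open_finite_preimage)
    show "z \<in> N" using r(1) \<epsilon>(1) z by (auto simp: N_def finite_preimage_def)
    show "N \<subseteq> ?P" using r(2) by (auto simp: N_def)
    show "inj_on f N" using r(4) by (rule inj_on_subset) (auto simp: N_def)
    show "0 < \<epsilon>" "ball (f z) \<epsilon> \<subseteq> B" using \<epsilon> by auto
    show "h (f x) = x" if "x \<in> N" for x using that h(2) by (auto simp: N_def)
    have im: "\<exists>x\<in>N. f x = w" if w: "w \<in> ball (f z) \<epsilon>" for w
    proof -
      obtain x where x: "x \<in> ball z r" "w = f x" using w \<epsilon>(2) by blast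
      hence "x \<in> finite_preimage f (ball (f z) \<epsilon>)" using w r(2) by (auto simp: finite_preimage_def)
      with x show ?thesis by (auto simp: N_def)
    qed
    show "inverse_branch f (ball (f z) \<epsilon>) h"
      unfolding inverse_branch_def
    proof (intro conjI ballI)
      show "h holomorphic_on ball (f z) \<epsilon>" using h(1) by (rule holomorphic_on_subset) (use \<epsilon>(2) in auto)
      fix w assume "w \<in> ball (f z) \<epsilon>"
      then obtain x where x: "x \<in> N" "f x = w" using im by blast
      hence "h w = x" using h(2) by (auto simp: N_def)
      with x show "\<not> is_pole f (h w)" "f (h w) = w" by (auto simp: N_def finite_preimage_def)
    qed
  qed
qed

text \<open>
  Over \<open>B\<close> the function \<open>f\<close> is locally injective, which makes the set where two lifts agree open; it is closed
  by continuity.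
\<close>
lemma lifts_agree:
  fixes g h :: "'a::topological_space \<Rightarrow> complex"
  assumes conn: "connected X" and cont: "continuous_on X g" "continuous_on X h"
    and pre: "\<And>x. x \<in> X \<Longrightarrow> g x \<in> finite_preimage f B"
    and eq: "\<And>x. x \<in> X \<Longrightarrow> f (g x) = f (h x)"
    and x0: "x0 \<in> X" "g x0 = h x0" and x: "x \<in> X"
  shows "g x = h x"
proof -
  define E where "E = {x \<in> X. g x - h x = 0}"
  have "closedin (top_of_set X) E"
    unfolding E_def by (intro continuous_closedin_preimage_constant continuous_intros cont)
  moreover have "openin (top_of_set X) E"
    unfolding openin_subopen[of _ E]
  proof
    fix y assume y: "y \<in> E"
    hence "g y \<in> finite_preimage f B" using pre[of y] by (simp add: E_def)
    then obtain N where N: "open N" "g y \<in> N" "inj_on f N"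
      using local_branch by metis
    define T where "T = (X \<inter> g -` N) \<inter> (X \<inter> h -` N)"
    have "openin (top_of_set X) T"
      unfolding T_def using N(1) cont by (intro openin_Int continuous_openin_preimage_gen)
    moreover have "y \<in> T" using y N(2) by (auto simp: T_def E_def)
    moreover have "T \<subseteq> E"
      using eq inj_onD[OF N(3)] by (auto simp: T_def E_def)
    ultimately show "\<exists>T. openin (top_of_set X) T \<and> y \<in> T \<and> T \<subseteq> E" by blast
  qed
  ultimately have "E = {} \<or> E = X" using conn unfolding connected_clopen by blast
  moreover have "x0 \<in> E" using x0 by (simp add: E_def)
  ultimately have "x \<in> E" using x by auto
  thus ?thesis by (simp add: E_def)
qed

lemma branches_agree:
  assumes "inverse_branch f D g" "inverse_branch f D' h" "connected C" "C \<subseteq> D" "C \<subseteq> D'" "D \<subseteq> B"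
    and "x0 \<in> C" "g x0 = h x0" "x \<in> C"
  shows "g x = h x"
proof -
  have cont: "continuous_on C g" "continuous_on C h"
    using continuous_on_subset[OF inverse_branchD(2)[OF assms(1)] assms(4)]
      continuous_on_subset[OF inverse_branchD(2)[OF assms(2)] assms(5)] .
  have pre: "g y \<in> finite_preimage f B" if "y \<in> C" for y
    using inverse_branch_in_preimage[OF assms(1,6)] that assms(4) by blast
  have eq: "f (g y) = f (h y)" if "y \<in> C" for y
    using that assms(1,2,4,5) inverse_branchD(4) by (metis subsetD)
  show ?thesis
    by (rule lifts_agree[OF assms(3) cont]) (use pre eq assms(7-9) in auto)
qed

text \<open>
  If \<open>g\<close> does not tend to infinity at \<open>a\<close>, it has a finite limit \<open>z\<close> along some sequence. This \<open>z\<close> is not a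
  pole and \<open>f z = a\<close>, so the local inverse of \<open>f\<close> at \<open>z\<close> continues \<open>g\<close>.
\<close>
lemma branch_extends_or_tends_to_infinity:
  assumes br: "inverse_branch f (ball w \<rho>) g" and sub: "ball w \<rho> \<subseteq> B"
    and a: "dist w a = \<rho>" "a \<in> B"
    and no: "\<not> filterlim g at_infinity (at a within ball w \<rho>)"
  obtains \<epsilon> k where "0 < \<epsilon>" "ball a \<epsilon> \<subseteq> B" "inverse_branch f (ball a \<epsilon>) k"
    "\<And>x. x \<in> ball a \<epsilon> \<inter> ball w \<rho> \<Longrightarrow> k x = g x"
proof -
  let ?D = "ball w \<rho>"
  obtain M where M: "\<not> eventually (\<lambda>x. M \<le> cmod (g x)) (at a within ?D)"
    using no unfolding filterlim_at_infinity[OF order.refl] by blast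
  have "\<exists>x. x \<in> ?D \<and> dist x a < inverse (real (Suc n)) \<and> cmod (g x) \<le> M" for n
  proof (rule ccontr)
    assume "\<not> ?thesis"
    hence "\<forall>x\<in>?D. x \<noteq> a \<and> dist x a < inverse (real (Suc n)) \<longrightarrow> M \<le> cmod (g x)" by force
    hence "eventually (\<lambda>x. M \<le> cmod (g x)) (at a within ?D)"
      unfolding eventually_at by (intro exI[of _ "inverse (real (Suc n))"]) auto
    thus False using M by blast
  qed
  then obtain x where x: "\<And>n. x n \<in> ?D" "\<And>n. dist (x n) a < inverse (real (Suc n))"
    "\<And>n. cmod (g (x n)) \<le> M" by metis
  have xlim: "x \<longlonglongrightarrow> a"
  proof (rule metric_LIMSEQ_I)
    fix r :: real assume "0 < r"
    then obtain N where N: "inverse (real (Suc N)) < r" using reals_Archimedean by blast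
    have "dist (x n) a < r" if "N \<le> n" for n
    proof -
      have "inverse (real (Suc n)) \<le> inverse (real (Suc N))" using that by (intro le_imp_inverse_le) auto
      thus ?thesis using x(2)[of n] N by linarith
    qed
    thus "\<exists>N. \<forall>n\<ge>N. dist (x n) a < r" by blast
  qed
  have "bounded (range (\<lambda>n. g (x n)))" using x(3) by (auto simp: bounded_iff)
  from bounded_imp_convergent_subsequence[OF this]
  obtain z r where r: "strict_mono (r :: nat \<Rightarrow> nat)" "((\<lambda>n. g (x n)) \<circ> r) \<longlonglongrightarrow> z" by auto
  define y where "y = x \<circ> r"
  have y: "y n \<in> ?D" for n using x(1) by (simp add: y_def)
  have ylim: "y \<longlonglongrightarrow> a" unfolding y_def using xlim r(1) by (rule LIMSEQ_subseq_LIMSEQ)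
  have glim: "(\<lambda>n. g (y n)) \<longlonglongrightarrow> z" using r(2) by (simp add: y_def o_def)
  have fg: "f (g (y n)) = y n" "\<not> is_pole f (g (y n))" for n
    using inverse_branchD(3,4)[OF br] y by auto
  have np: "\<not> is_pole f z"
  proof
    assume p: "is_pole f z"
    hence "eventually (\<lambda>n. g (y n) \<noteq> z) sequentially"
      using fg(2) by (auto intro!: always_eventually)
    hence "filterlim (\<lambda>n. g (y n)) (at z) sequentially"
      using glim by (auto simp: filterlim_at)
    hence "filterlim (\<lambda>n. f (g (y n))) at_infinity sequentially"
      using p unfolding is_pole_def by (rule filterlim_compose[rotated])
    hence "filterlim y at_infinity sequentially" by (simp add: fg)
    thus False using ylim not_tendsto_and_filterlim_at_infinity by (metis sequentially_bot)
  qed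
  have "isCont f z" using analytic_off_poles[OF np] by (rule analytic_at_imp_isCont)
  hence "(\<lambda>n. f (g (y n))) \<longlonglongrightarrow> f z" using glim by (rule isCont_tendsto_compose)
  hence fz: "f z = a" using ylim LIMSEQ_unique by (simp add: fg)
  have "z \<in> finite_preimage f B" using np fz a(2) by (simp add: finite_preimage_def)
  then obtain N \<epsilon> k where N: "open N" "z \<in> N" "0 < \<epsilon>" "ball a \<epsilon> \<subseteq> B" "inverse_branch f (ball a \<epsilon>) k"
    "\<And>x. x \<in> N \<Longrightarrow> k (f x) = x"
    using local_branch[of z] fz by metis
  have "eventually (\<lambda>n. g (y n) \<in> N) sequentially" using glim N(1,2) by (rule topological_tendstoD)
  moreover have "eventually (\<lambda>n. dist (y n) a < \<epsilon>) sequentially" using ylim N(3) by (rule tendstoD)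
  ultimately have "eventually (\<lambda>n. g (y n) \<in> N \<and> dist (y n) a < \<epsilon>) sequentially"
    by (rule eventually_conj)
  then obtain n where n: "g (y n) \<in> N" "dist (y n) a < \<epsilon>"
    using eventually_happens'[OF sequentially_bot] by blast
  have "k x = g x" if "x \<in> ball a \<epsilon> \<inter> ?D" for x
  proof (rule branches_agree[OF N(5) br _ _ _ N(4)])
    show "connected (ball a \<epsilon> \<inter> ?D)" by (intro convex_connected convex_Int convex_ball)
    show "y n \<in> ball a \<epsilon> \<inter> ?D" using n(2) y by (simp add: dist_commute)
    show "k (y n) = g (y n)" using N(6)[OF n(1)] fg by simp
  qed (use that in auto)
  with N show ?thesis using that by blast
qed

text \<open>
  The local extensions at the boundary points glue, because the overlap of any two of them is
  convex and meets the disc. By compactness their union contains a larger disc.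
\<close>
lemma branch_on_larger_ball:
  assumes br: "inverse_branch f (ball w \<rho>) g" and "0 < \<rho>" and sub: "cball w \<rho> \<subseteq> B"
    and no: "\<And>a. dist w a = \<rho> \<Longrightarrow> \<not> filterlim g at_infinity (at a within ball w \<rho>)"
  obtains \<delta> G where "0 < \<delta>" "inverse_branch f (ball w (\<rho> + \<delta>)) G" "\<And>x. x \<in> ball w \<rho> \<Longrightarrow> G x = g x"
proof -
  let ?D = "ball w \<rho>" and ?S = "sphere w \<rho>"
  have D: "?D \<subseteq> B" using sub by auto
  have "\<exists>\<epsilon> k. 0 < \<epsilon> \<and> ball a \<epsilon> \<subseteq> B \<and> inverse_branch f (ball a \<epsilon>) k \<and> (\<forall>x\<in>ball a \<epsilon> \<inter> ?D. k x = g x)"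
    if "a \<in> ?S" for a
  proof -
    have "dist w a = \<rho>" "a \<in> B" using that sub by auto
    from branch_extends_or_tends_to_infinity[OF br D this no[OF this(1)]] show ?thesis by metis
  qed
  then obtain \<epsilon> k where k: "\<And>a. a \<in> ?S \<Longrightarrow> 0 < \<epsilon> a \<and> ball a (\<epsilon> a) \<subseteq> B \<and> inverse_branch f (ball a (\<epsilon> a)) (k a)
      \<and> (\<forall>x\<in>ball a (\<epsilon> a) \<inter> ?D. k a x = g x)" by metis
  have kk: "k a x = k b x" if ab: "a \<in> ?S" "b \<in> ?S" "x \<in> ball a (\<epsilon> a)" "x \<in> ball b (\<epsilon> b)" for a b x
  proof -
    let ?C = "ball a (\<epsilon> a) \<inter> ball b (\<epsilon> b)"
    have "?C \<inter> ?D \<noteq> {}"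
    proof (rule meeting_balls_meet_center_ball)
      show "a \<in> cball w \<rho>" "b \<in> cball w \<rho>" using ab(1,2) by auto
      show "?C \<noteq> {}" using ab(3,4) by blast
    qed (rule \<open>0 < \<rho>\<close>)
    then obtain q where q: "q \<in> ?C" "q \<in> ?D" by blast
    show ?thesis
    proof (rule branches_agree[of "ball a (\<epsilon> a)" "k a" "ball b (\<epsilon> b)" "k b" ?C q])
      show "connected ?C" by (intro convex_connected convex_Int convex_ball)
      show "inverse_branch f (ball a (\<epsilon> a)) (k a)" "ball a (\<epsilon> a) \<subseteq> B" using k[OF ab(1)] by blast+
      show "inverse_branch f (ball b (\<epsilon> b)) (k b)" using k[OF ab(2)] by blast
      have "k a q = g q" using k[OF ab(1)] q by blast
      moreover have "k b q = g q" using k[OF ab(2)] q by blast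
      ultimately show "k a q = k b q" by simp
      show "x \<in> ?C" using ab(3,4) by blast
    qed (use q in blast)+
  qed
  define U where "U a = (if a = w then ?D else ball a (\<epsilon> a))" for a
  define h where "h a = (if a = w then g else k a)" for a
  have w: "w \<notin> ?S" using \<open>0 < \<rho>\<close> by simp
  obtain G where G: "inverse_branch f (\<Union>a\<in>insert w ?S. U a) G"
    "\<And>a x. a \<in> insert w ?S \<Longrightarrow> x \<in> U a \<Longrightarrow> G x = h a x"
  proof (rule inverse_branch_UN[of "insert w ?S" f U h])
    show "inverse_branch f (U a) (h a)" if "a \<in> insert w ?S" for a
      using that br k[of a] by (cases "a = w") (simp_all add: U_def h_def)
    show "open (U a)" for a by (simp add: U_def)
    show "h a x = h b x" if ab: "a \<in> insert w ?S" "b \<in> insert w ?S" "x \<in> U a" "x \<in> U b" for a b x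
    proof -
      consider "a = w" "b = w" | "a = w" "b \<in> ?S" "b \<noteq> w" | "a \<in> ?S" "b = w" "a \<noteq> w" | "a \<in> ?S" "b \<in> ?S" "a \<noteq> w" "b \<noteq> w"
        using ab(1,2) w by blast
      thus ?thesis
      proof cases
        case 1 thus ?thesis by simp
      next
        case 2 thus ?thesis using ab k[of b] by (simp add: U_def h_def)
      next
        case 3 thus ?thesis using ab k[of a] by (simp add: U_def h_def)
      next
        case 4 thus ?thesis using ab kk[of a b x] by (simp add: U_def h_def)
      qed
    qed
  qed blast
  have "open (\<Union>a\<in>insert w ?S. U a)" by (auto simp: U_def)
  moreover have "cball w \<rho> \<subseteq> (\<Union>a\<in>insert w ?S. U a)"
  proof
    fix x assume x: "x \<in> cball w \<rho>"
    show "x \<in> (\<Union>a\<in>insert w ?S. U a)"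
    proof (cases "x \<in> ?D")
      case True thus ?thesis by (auto simp: U_def)
    next
      case False
      hence "x \<in> ?S" using x by auto
      hence "x \<in> U x" using k[of x] w by (auto simp: U_def)
      with \<open>x \<in> ?S\<close> show ?thesis by blast
    qed
  qed
  ultimately obtain \<delta> where \<delta>: "0 < \<delta>" "(\<Union>x\<in>cball w \<rho>. ball x \<delta>) \<subseteq> (\<Union>a\<in>insert w ?S. U a)"
    using compact_subset_open_imp_ball_epsilon_subset[OF compact_cball] by metis
  from \<open>0 < \<rho>\<close> \<delta>(1) have "ball w (\<rho> + \<delta>) \<subseteq> (\<Union>x\<in>cball w \<rho>. ball x \<delta>)"
    by (rule ball_subset_UN_balls)
  hence "ball w (\<rho> + \<delta>) \<subseteq> (\<Union>a\<in>insert w ?S. U a)" using \<delta>(2) by (rule subset_trans)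
  with G(1) have "inverse_branch f (ball w (\<rho> + \<delta>)) G" by (rule inverse_branch_subset)
  moreover have "G x = g x" if "x \<in> ?D" for x using G(2)[of w x] that by (simp add: U_def h_def)
  ultimately show ?thesis using that \<delta>(1) by blast
qed

text \<open>
  Take the supremum of the radii on which the branch exists. At a supremum below \<open>R\<close>
  the branch could be continued further, unless it tended to infinity at some boundary point, which is
  excluded by hypothesis. The hypothesis leaves out \<open>a = f z\<close>, which is never a boundary point, so that the lemma
  applies to a disc about a point that may itself be asymptotic.
\<close>
lemma maximal_branch:
  assumes z: "\<not> is_pole f z" and R: "0 < R" "ball (f z) R \<subseteq> B"
    and no: "\<And>\<rho> a g. \<rho> < R \<Longrightarrow> a \<noteq> f z \<Longrightarrow> \<not> asymptotic_branch f (f z) \<rho> a g"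
  obtains g where "inverse_branch f (ball (f z) R) g" "g (f z) = z"
proof -
  define w where "w = f z"
  define P where "P \<rho> g \<longleftrightarrow> 0 < \<rho> \<and> \<rho> \<le> R \<and> inverse_branch f (ball w \<rho>) g \<and> g w = z" for \<rho> g
  define S where "S = {\<rho>. \<exists>g. P \<rho> g}"
  have zB: "z \<in> finite_preimage f B" using z R by (auto simp: finite_preimage_def)
  obtain N \<epsilon> h where h: "0 < \<epsilon>" "inverse_branch f (ball w \<epsilon>) h" "z \<in> N" "\<And>x. x \<in> N \<Longrightarrow> h (f x) = x"
    using local_branch[OF zB] unfolding w_def by metis
  have "inverse_branch f (ball w (min \<epsilon> R)) h" using h(2) by (rule inverse_branch_subset) auto
  hence "P (min \<epsilon> R) h" using h R by (auto simp: P_def w_def)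
  hence ne: "min \<epsilon> R \<in> S" unfolding S_def by blast
  have bdd: "bdd_above S" by (rule bdd_aboveI[of _ R]) (auto simp: S_def P_def)
  define \<sigma> where "\<sigma> = Sup S"
  have "min \<epsilon> R \<le> \<sigma>" unfolding \<sigma>_def using ne bdd by (rule cSup_upper)
  hence "0 < \<sigma>" using h(1) R(1) by linarith
  have "S \<noteq> {}" using ne by blast
  hence "\<sigma> \<le> R" unfolding \<sigma>_def by (rule cSup_least) (auto simp: S_def P_def)
  have "\<forall>\<rho>\<in>S. \<exists>g. P \<rho> g" by (simp add: S_def)
  then obtain g where g: "\<And>\<rho>. \<rho> \<in> S \<Longrightarrow> P \<rho> (g \<rho>)" by metis
  obtain G where G: "inverse_branch f (\<Union>\<rho>\<in>S. ball w \<rho>) G"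
    "\<And>\<rho> x. \<rho> \<in> S \<Longrightarrow> x \<in> ball w \<rho> \<Longrightarrow> G x = g \<rho> x"
  proof (rule inverse_branch_UN[of S f "ball w" g])
    show "inverse_branch f (ball w \<rho>) (g \<rho>)" if "\<rho> \<in> S" for \<rho> using g[OF that] by (simp add: P_def)
    show "g \<rho> x = g \<sigma> x" if "\<rho> \<in> S" "\<sigma> \<in> S" "x \<in> ball w \<rho>" "x \<in> ball w \<sigma>" for \<rho> \<sigma> x
    proof (rule branches_agree[of "ball w \<rho>" "g \<rho>" "ball w \<sigma>" "g \<sigma>" "ball w \<rho> \<inter> ball w \<sigma>" w])
      show "connected (ball w \<rho> \<inter> ball w \<sigma>)" by (intro convex_connected convex_Int convex_ball)
      show "inverse_branch f (ball w \<rho>) (g \<rho>)" "inverse_branch f (ball w \<sigma>) (g \<sigma>)"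
        "g \<rho> w = g \<sigma> w" "w \<in> ball w \<rho> \<inter> ball w \<sigma>"
        using g[OF that(1)] g[OF that(2)] by (auto simp: P_def)
      have "ball w \<rho> \<subseteq> ball w R" using g[OF that(1)] by (auto simp: P_def)
      thus "ball w \<rho> \<subseteq> B" using R(2) unfolding w_def by (rule subset_trans)
    qed (use that in auto)
  qed auto
  have "ball w \<sigma> \<subseteq> (\<Union>\<rho>\<in>S. ball w \<rho>)"
  proof
    fix x assume "x \<in> ball w \<sigma>"
    hence "dist w x < Sup S" by (simp add: \<sigma>_def)
    then obtain \<rho> where "\<rho> \<in> S" "dist w x < \<rho>" using less_cSup_iff[OF _ bdd] ne by blast
    thus "x \<in> (\<Union>\<rho>\<in>S. ball w \<rho>)" by auto
  qed
  with G(1) have Gb: "inverse_branch f (ball w \<sigma>) G" by (rule inverse_branch_subset)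
  have Gw: "G w = z" using G(2)[OF ne, of w] g[OF ne] by (simp add: P_def)
  show ?thesis
  proof (cases "\<sigma> = R")
    case True thus ?thesis using that Gb Gw unfolding w_def by blast
  next
    case False
    with \<open>\<sigma> \<le> R\<close> have "\<sigma> < R" by simp
    have "\<not> filterlim G at_infinity (at a within ball w \<sigma>)" if "dist w a = \<sigma>" for a
    proof
      assume "filterlim G at_infinity (at a within ball w \<sigma>)"
      with that Gb \<open>0 < \<sigma>\<close> have "asymptotic_branch f (f z) \<sigma> a G" by (simp add: asymptotic_branch_def w_def)
      moreover have "a \<noteq> f z" using that \<open>0 < \<sigma>\<close> by (auto simp: w_def)
      ultimately show False using no \<open>\<sigma> < R\<close> by blast
    qed
    moreover have "cball w \<sigma> \<subseteq> ball w R" using \<open>\<sigma> < R\<close> by auto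
    hence "cball w \<sigma> \<subseteq> B" using R(2) unfolding w_def by (rule subset_trans)
    ultimately obtain \<delta> H where H: "0 < \<delta>" "inverse_branch f (ball w (\<sigma> + \<delta>)) H"
      "\<And>x. x \<in> ball w \<sigma> \<Longrightarrow> H x = G x"
      using branch_on_larger_ball[OF Gb \<open>0 < \<sigma>\<close>] by metis
    define \<rho> where "\<rho> = min (\<sigma> + \<delta>) R"
    have "inverse_branch f (ball w \<rho>) H" using H(2) by (rule inverse_branch_subset) (auto simp: \<rho>_def)
    moreover have "H w = z" using H(3)[of w] Gw \<open>0 < \<sigma>\<close> by simp
    ultimately have "P \<rho> H" using \<open>0 < \<sigma>\<close> H(1) R(1) by (simp add: P_def \<rho>_def)
    hence "\<rho> \<le> \<sigma>" unfolding \<sigma>_def using bdd by (intro cSup_upper) (auto simp: S_def)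
    thus ?thesis using H(1) \<open>\<sigma> < R\<close> by (simp add: \<rho>_def)
  qed
qed

end

section \<open>Growth of a branch at an asymptotic point\<close>

text \<open>
  For \<open>g = u + \<i>v\<close> with \<open>|g'| \<le> L (1 + |g|\<^sup>2)\<^sup>m\<close> the quantity \<open>1/(1 + |g|\<^sup>2)\<^sup>m\<close> has bounded derivative:
  its derivative is at most \<open>m\<close> times \<open>2 |g| |g'| / (1 + |g|\<^sup>2)\<^sup>m\<^sup>+\<^sup>1\<close>, and \<open>2 |g| \<le> 1 + |g|\<^sup>2\<close>.
\<close>
lemma power_inverse_lipschitz_step:
  fixes u v :: "real \<Rightarrow> real"
  assumes u: "(u has_real_derivative u') (at t)" and v: "(v has_real_derivative v') (at t)"
    and bound: "cmod (Complex u' v') \<le> L * (1 + (u t)\<^sup>2 + (v t)\<^sup>2) ^ m"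
  shows "\<exists>D. ((\<lambda>t. inverse ((1 + (u t)\<^sup>2 + (v t)\<^sup>2) ^ m)) has_real_derivative D) (at t) \<and> \<bar>D\<bar> \<le> real m * L"
proof -
  define Q where "Q = 1 + (u t)\<^sup>2 + (v t)\<^sup>2"
  have Q: "1 \<le> Q" by (simp add: Q_def)
  define P' where "P' = 2 * (u t * u' + v t * v')"
  have dP: "((\<lambda>t. 1 + (u t)\<^sup>2 + (v t)\<^sup>2) has_real_derivative P') (at t)"
    by (rule derivative_eq_intros u v refl)+ (simp add: P'_def algebra_simps)
  have "((\<lambda>t. (1 + (u t)\<^sup>2 + (v t)\<^sup>2) ^ m) has_real_derivative real m * (P' * Q ^ (m - 1))) (at t)"
    using DERIV_power[OF dP, of m] by (simp add: Q_def)
  moreover have "Q ^ m \<noteq> 0" using Q by simp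
  ultimately have "((\<lambda>t. inverse ((1 + (u t)\<^sup>2 + (v t)\<^sup>2) ^ m)) has_real_derivative
      - (inverse (Q ^ m) * (real m * (P' * Q ^ (m - 1))) * inverse (Q ^ m))) (at t)"
    unfolding Q_def by (rule DERIV_inverse')
  moreover have "\<bar>- (inverse (Q ^ m) * (real m * (P' * Q ^ (m - 1))) * inverse (Q ^ m))\<bar> \<le> real m * L"
  proof (cases "m = 0")
    case False
    have "\<bar>u t * u' + v t * v'\<bar> \<le> cmod (Complex (u t) (v t)) * cmod (Complex u' v')"
      using Cauchy_Schwarz_ineq2[of "Complex (u t) (v t)" "Complex u' v'"] by (simp add: inner_complex_def)
    hence 1: "\<bar>P'\<bar> \<le> 2 * cmod (Complex (u t) (v t)) * cmod (Complex u' v')"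
      unfolding P'_def abs_mult by simp
    have sq: "(cmod (Complex (u t) (v t)))\<^sup>2 + 1 = Q" by (simp add: Q_def cmod_power2)
    have "2 * cmod (Complex (u t) (v t)) \<le> Q"
      using sum_squares_bound[of "cmod (Complex (u t) (v t))" 1] sq by simp
    hence "2 * cmod (Complex (u t) (v t)) * cmod (Complex u' v') \<le> Q * (L * Q ^ m)"
      using bound Q by (intro mult_mono) (auto simp: Q_def)
    with 1 have 2: "\<bar>P'\<bar> \<le> L * (Q * Q ^ m)" by (simp add: mult_ac)
    have Qm: "Q ^ m = Q * Q ^ (m - 1)" using False by (cases m) auto
    have pos: "0 < Q ^ m" "0 < Q ^ (m - 1)" using Q by auto
    have "\<bar>P'\<bar> * Q ^ (m - 1) / (Q ^ m * Q ^ m) \<le> L * (Q * Q ^ m) * Q ^ (m - 1) / (Q ^ m * Q ^ m)"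
      using 2 pos by (intro divide_right_mono mult_right_mono) auto
    moreover have "L * (Q * Q ^ m) * Q ^ (m - 1) = L * (Q ^ m * Q ^ m)"
      by (simp add: Qm mult_ac)
    moreover have "Q ^ m * Q ^ m \<noteq> 0" using Q by simp
    ultimately have "\<bar>P'\<bar> * Q ^ (m - 1) / (Q ^ m * Q ^ m) \<le> L"
      by (metis nonzero_mult_div_cancel_right)
    hence "real m * (\<bar>P'\<bar> * Q ^ (m - 1) / (Q ^ m * Q ^ m)) \<le> real m * L"
      by (rule mult_left_mono) simp
    moreover have "\<bar>- (inverse (Q ^ m) * (real m * (P' * Q ^ (m - 1))) * inverse (Q ^ m))\<bar>
        = real m * (\<bar>P'\<bar> * Q ^ (m - 1) / (Q ^ m * Q ^ m))"
      using Q by (simp add: abs_mult divide_inverse mult_ac)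
    ultimately show ?thesis by simp
  qed simp
  ultimately show ?thesis by blast
qed


text \<open>
  The negation of the conclusion of the main theorem, with \<open>\<tau>\<close> replaced by an even integer.
\<close>
locale expanding_over = noncritical_over f B for f B +
  fixes C :: real and m :: nat
  assumes expanding: "\<And>z. z \<in> finite_preimage f B \<Longrightarrow> 1 \<le> C * (1 + (cmod z)\<^sup>2) ^ m * cmod (deriv f z)"
begin

text \<open>
  The expansion of \<open>f\<close>, read off the inverse branch by the chain rule.
\<close>
lemma branch_derivative_bound:
  assumes br: "inverse_branch f D g" and D: "open D" "D \<subseteq> B" and w: "w \<in> D"
  shows "cmod (deriv g w) \<le> C * (1 + (cmod (g w))\<^sup>2) ^ m"
proof -
  have np: "\<not> is_pole f (g w)" using inverse_branchD(3)[OF br w] .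
  have df: "(f has_field_derivative deriv f (g w)) (at (g w))"
    using analytic_off_poles[OF np] analytic_on_imp_differentiable_at
    by (simp add: DERIV_deriv_iff_field_differentiable)
  have dg: "(g has_field_derivative deriv g w) (at w)"
    using inverse_branchD(1)[OF br] D(1) w by (rule holomorphic_derivI)
  have "((\<lambda>x. f (g x)) has_field_derivative deriv f (g w) * deriv g w) (at w)"
    using DERIV_chain2[OF df dg] .
  moreover have "((\<lambda>x. x) has_field_derivative 1) (at w)" by (rule DERIV_ident)
  hence "((\<lambda>x. f (g x)) has_field_derivative 1) (at w)"
    using D(1) w
  proof (rule has_field_derivative_transform_within_open)
    show "x = f (g x)" if "x \<in> D" for x using inverse_branchD(4)[OF br that] by simp
  qed
  ultimately have "deriv f (g w) * deriv g w = 1" by (rule DERIV_unique)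
  hence one: "cmod (deriv f (g w)) * cmod (deriv g w) = 1" by (metis norm_mult norm_one)
  have "1 \<le> C * (1 + (cmod (g w))\<^sup>2) ^ m * cmod (deriv f (g w))"
    using inverse_branch_in_preimage[OF br D(2) w] by (rule expanding)
  hence "1 * cmod (deriv g w) \<le> C * (1 + (cmod (g w))\<^sup>2) ^ m * cmod (deriv f (g w)) * cmod (deriv g w)"
    by (rule mult_right_mono) simp
  thus ?thesis using one by (simp add: mult.assoc)
qed

lemma branch_lipschitz:
  assumes br: "inverse_branch f D g" and D: "open D" "convex D" "D \<subseteq> B" and xy: "x \<in> D" "y \<in> D"
  shows "\<bar>inverse ((1 + (cmod (g x))\<^sup>2) ^ m) - inverse ((1 + (cmod (g y))\<^sup>2) ^ m)\<bar> \<le> real m * C * dist x y"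
proof -
  define p where "p t = y + of_real t * (x - y)" for t :: real
  define u where "u t = Re (g (p t))" for t
  define v where "v t = Im (g (p t))" for t
  define q where "q t = inverse ((1 + (u t)\<^sup>2 + (v t)\<^sup>2) ^ m)" for t
  have "\<exists>D'. (q has_real_derivative D') (at t) \<and> \<bar>D'\<bar> \<le> real m * (C * dist x y)" if t: "0 \<le> t" "t \<le> 1" for t
  proof -
    have "(1 - t) *\<^sub>R y + t *\<^sub>R x \<in> D" using xy t by (intro convexD_alt[OF D(2)])
    hence pD: "p t \<in> D" by (simp add: p_def scaleR_conv_of_real algebra_simps)
    have dg: "(g has_field_derivative deriv g (p t)) (at (p t))"
      using inverse_branchD(1)[OF br] D(1) pD by (rule holomorphic_derivI)
    have "(p has_vector_derivative (x - y)) (at t)"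
      unfolding p_def by (auto intro!: derivative_eq_intros)
    from field_vector_diff_chain_at[OF this dg]
    have dv: "((\<lambda>t. g (p t)) has_vector_derivative (x - y) * deriv g (p t)) (at t)" by (simp add: o_def)
    define w where "w = (x - y) * deriv g (p t)"
    have du: "(u has_real_derivative Re w) (at t)"
      using bounded_linear.has_vector_derivative[OF bounded_linear_Re dv]
      by (simp add: u_def[abs_def] w_def has_real_derivative_iff_has_vector_derivative)
    have dv': "(v has_real_derivative Im w) (at t)"
      using bounded_linear.has_vector_derivative[OF bounded_linear_Im dv]
      by (simp add: v_def[abs_def] w_def has_real_derivative_iff_has_vector_derivative)
    have "cmod w = dist x y * cmod (deriv g (p t))" by (simp add: w_def norm_mult dist_norm)
    also have "\<dots> \<le> dist x y * (C * (1 + (cmod (g (p t)))\<^sup>2) ^ m)"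
      using branch_derivative_bound[OF br D(1,3) pD] by (rule mult_left_mono) simp
    finally have "cmod (Complex (Re w) (Im w)) \<le> (C * dist x y) * (1 + (u t)\<^sup>2 + (v t)\<^sup>2) ^ m"
      by (simp add: u_def v_def cmod_power2 add.assoc mult_ac)
    from power_inverse_lipschitz_step[OF du dv' this] show ?thesis unfolding q_def .
  qed
  then obtain q' where q': "\<And>t. 0 \<le> t \<Longrightarrow> t \<le> 1 \<Longrightarrow> (q has_real_derivative q' t) (at t)"
    "\<And>t. 0 \<le> t \<Longrightarrow> t \<le> 1 \<Longrightarrow> \<bar>q' t\<bar> \<le> real m * (C * dist x y)" by metis
  obtain t where t: "0 < t" "t < 1" "q 1 - q 0 = (1 - 0) * q' t"
    using MVT2[of 0 1 q q'] q'(1) by auto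
  have "\<bar>q 1 - q 0\<bar> \<le> real m * (C * dist x y)" using t q'(2)[of t] by simp
  moreover have "q 1 = inverse ((1 + (cmod (g x))\<^sup>2) ^ m)" "q 0 = inverse ((1 + (cmod (g y))\<^sup>2) ^ m)"
    by (simp_all add: q_def u_def v_def p_def cmod_power2 add.assoc)
  ultimately show ?thesis by (simp add: mult.assoc)
qed

text \<open>
  The Lipschitz function of \<open>branch_lipschitz\<close> tends to zero at \<open>a\<close>, hence is at most a multiple of
  the distance to \<open>a\<close>.
\<close>
lemma asymptotic_branch_growth:
  assumes as: "asymptotic_branch f w \<rho> a g" and sub: "ball w \<rho> \<subseteq> B" and m: "0 < m" and x: "x \<in> ball w \<rho>"
  shows "1 \<le> real m * C * dist x a * (1 + (cmod (g x))\<^sup>2) ^ m"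
proof -
  let ?D = "ball w \<rho>"
  have br: "inverse_branch f ?D g" and lim: "filterlim g at_infinity (at a within ?D)"
    and \<rho>: "0 < \<rho>" "dist w a = \<rho>" using as by (auto simp: asymptotic_branch_def)
  have "a \<in> closure ?D" using \<rho> by simp
  moreover have "a \<notin> ?D" using \<rho> by simp
  ultimately have nb: "at a within ?D \<noteq> bot"
    by (simp add: closure_def trivial_limit_within)
  have "filterlim (\<lambda>y. cmod (g y)) at_top (at a within ?D)"
    using lim by (simp add: filterlim_at_infinity_conv_norm_at_top)
  hence "filterlim (\<lambda>y. (cmod (g y))\<^sup>2) at_top (at a within ?D)"
    by (rule filterlim_pow_at_top[rotated]) simp
  hence "filterlim (\<lambda>y. 1 + (cmod (g y))\<^sup>2) at_top (at a within ?D)"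
    by (rule filterlim_tendsto_add_at_top[OF tendsto_const])
  hence "filterlim (\<lambda>y. (1 + (cmod (g y))\<^sup>2) ^ m) at_top (at a within ?D)"
    by (rule filterlim_pow_at_top[OF m])
  hence q0: "((\<lambda>y. inverse ((1 + (cmod (g y))\<^sup>2) ^ m)) \<longlongrightarrow> 0) (at a within ?D)"
    by (rule tendsto_inverse_0_at_top)
  have "((\<lambda>y. real m * C * dist x y + inverse ((1 + (cmod (g y))\<^sup>2) ^ m)) \<longlongrightarrow> real m * C * dist x a + 0) (at a within ?D)"
    by (intro tendsto_intros q0)
  moreover have "eventually (\<lambda>y. inverse ((1 + (cmod (g x))\<^sup>2) ^ m)
      \<le> real m * C * dist x y + inverse ((1 + (cmod (g y))\<^sup>2) ^ m)) (at a within ?D)"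
    unfolding eventually_at_filter
  proof (rule always_eventually, intro allI impI)
    fix y assume "y \<in> ?D"
    from branch_lipschitz[OF br open_ball convex_ball sub x this]
    show "inverse ((1 + (cmod (g x))\<^sup>2) ^ m) \<le> real m * C * dist x y + inverse ((1 + (cmod (g y))\<^sup>2) ^ m)"
      by linarith
  qed
  ultimately have le: "inverse ((1 + (cmod (g x))\<^sup>2) ^ m) \<le> real m * C * dist x a + 0"
    using tendsto_lowerbound nb by blast
  have pos: "0 < (1 + (cmod (g x))\<^sup>2) ^ m" by (intro zero_less_power add_pos_nonneg) auto
  have "inverse ((1 + (cmod (g x))\<^sup>2) ^ m) * (1 + (cmod (g x))\<^sup>2) ^ m
      \<le> (real m * C * dist x a) * (1 + (cmod (g x))\<^sup>2) ^ m"
    using le pos by (intro mult_right_mono) auto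
  thus ?thesis unfolding left_inverse[OF less_imp_neq[OF pos, symmetric]] .
qed

end

section \<open>Finiteness of the asymptotic points\<close>

lemma cos_gt_half_near_zero:
  assumes "\<bar>y\<bar> < 1"
  shows "1/2 < cos (y::real)"
proof -
  have "cos (pi / 3) < cos \<bar>y\<bar>"
    using assms pi_gt3 by (intro cos_monotone_0_pi) auto
  thus ?thesis by (simp add: cos_60)
qed

text \<open>
  A disc that has \<open>a\<close> on its boundary contains the sector at \<open>a\<close> around its radius with
  half-angle \<open>1 < \<pi>/3\<close>, up to distance equal to the radius. The exponential parametrises this sector
  by the half-strip, and \<open>\<mu>\<close> shrinks it towards \<open>a\<close>.
\<close>
lemma half_strip_into_tangent_ball:
  assumes z: "z \<in> half_strip" and \<mu>: "0 < \<mu>" "\<mu> \<le> 1" and "w \<noteq> (a::complex)"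
  shows "a + (w - a) * of_real \<mu> * exp (-z) \<in> ball w (dist w a)"
    "dist (a + (w - a) * of_real \<mu> * exp (-z)) a < \<mu> * dist w a"
proof -
  define E where "E = of_real \<mu> * exp (-z)"
  have pos: "0 < cmod (w - a)" using \<open>w \<noteq> a\<close> by simp
  have zz: "0 < Re z" "\<bar>Im z\<bar> < 1" using z by (auto simp: half_strip_def)
  define e where "e = \<mu> * exp (- Re z)"
  have e: "0 < e" "e < \<mu>" using \<mu> zz by (auto simp: e_def)
  have cE: "cmod E = e" using \<mu> by (simp add: E_def e_def norm_mult norm_exp_eq_Re)
  have "Re E = e * cos (Im z)" by (simp add: E_def e_def Re_exp)
  moreover have "e * (1/2) < e * cos (Im z)" using cos_gt_half_near_zero[OF zz(2)] e by (intro mult_strict_left_mono) auto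
  ultimately have ReE: "e < 2 * Re E" by simp
  have "(cmod (E - 1))\<^sup>2 = (cmod E)\<^sup>2 - 2 * Re E + 1"
    unfolding cmod_power2 by (simp add: power2_eq_square algebra_simps)
  moreover have "e\<^sup>2 \<le> e" using e \<mu> by (simp add: power2_eq_square mult_left_le)
  ultimately have "(cmod (E - 1))\<^sup>2 < 1\<^sup>2" using ReE cE by simp
  hence E1: "cmod (E - 1) < 1" by (rule power_less_imp_less_base) simp
  have p: "a + (w - a) * of_real \<mu> * exp (-z) = a + (w - a) * E" by (simp add: E_def)
  have "a + (w - a) * E - w = (w - a) * (E - 1)" by (simp add: algebra_simps)
  hence "dist (a + (w - a) * E) w = cmod (w - a) * cmod (E - 1)" by (simp add: dist_norm norm_mult)
  hence "dist (a + (w - a) * E) w < cmod (w - a)" using E1 pos by (simp add: mult_less_cancel_left1)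
  thus "a + (w - a) * of_real \<mu> * exp (-z) \<in> ball w (dist w a)" unfolding p by (metis dist_commute dist_norm mem_ball)
  have "dist (a + (w - a) * E) a = cmod (w - a) * e" by (simp add: dist_norm norm_mult cE)
  also have "\<dots> < cmod (w - a) * \<mu>" using e pos by simp
  finally show "dist (a + (w - a) * of_real \<mu> * exp (-z)) a < \<mu> * dist w a"
    unfolding p by (simp add: dist_norm mult.commute)
qed

context expanding_over
begin

text \<open>
  Brings an asymptotic branch into the form required by \<open>disjoint_half_strips_bounded\<close>: in the
  coordinate \<open>Re z = ln (1/|w - a|)\<close>, up to a constant, growth by a power becomes exponential growth.
\<close>
lemma asymptotic_branch_half_strip:
  assumes as: "asymptotic_branch f w \<rho> a g" and sub: "ball w \<rho> \<subseteq> B" and m: "0 < m" and "0 < C" and "0 < \<delta>"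
  obtains T c where "T holomorphic_on half_strip" "inj_on T half_strip"
    "T ` half_strip \<subseteq> ball w \<rho> \<inter> ball a \<delta>" "0 < c"
    "\<And>z. z \<in> half_strip \<Longrightarrow> c * exp (Re z) \<le> cmod (g (T z)) ^ (2 * m)"
proof -
  have br: "inverse_branch f (ball w \<rho>) g" and lim: "filterlim g at_infinity (at a within ball w \<rho>)"
    and \<rho>: "0 < \<rho>" "dist w a = \<rho>" using as by (auto simp: asymptotic_branch_def)
  have wa: "w \<noteq> a" using \<rho> by auto
  have "eventually (\<lambda>x. 1 \<le> cmod (g x)) (at a within ball w \<rho>)"
    using lim by (simp add: filterlim_at_infinity[OF order.refl])
  then obtain d where d: "0 < d" "\<And>x. x \<in> ball w \<rho> \<Longrightarrow> x \<noteq> a \<Longrightarrow> dist x a < d \<Longrightarrow> 1 \<le> cmod (g x)"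
    unfolding eventually_at by blast
  \<comment> \<open>Small enough for \<open>|g| \<ge> 1\<close> on the sector, so that \<open>1 + |g|\<^sup>2\<close> may be replaced by \<open>2|g|\<^sup>2\<close>.\<close>
  define \<mu> where "\<mu> = min 1 (min d \<delta> / \<rho>)"
  have \<mu>: "0 < \<mu>" "\<mu> \<le> 1" using d \<open>0 < \<delta>\<close> \<rho> by (auto simp: \<mu>_def)
  have "\<mu> * \<rho> \<le> min d \<delta> / \<rho> * \<rho>" using \<rho>(1) by (intro mult_right_mono) (auto simp: \<mu>_def)
  hence \<mu>\<rho>: "\<mu> * \<rho> \<le> d" "\<mu> * \<rho> \<le> \<delta>" using \<rho>(1) by auto
  define T where "T z = a + (w - a) * of_real \<mu> * exp (-z)" for z
  have T: "T z \<in> ball w \<rho>" "dist (T z) a < \<mu> * \<rho>" if "z \<in> half_strip" for z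
    using half_strip_into_tangent_ball[OF that \<mu> wa] \<rho> by (simp_all add: T_def)
  define c where "c = inverse (real m * C * (\<mu> * \<rho>) * 2 ^ m)"
  show ?thesis
  proof (rule that[of T c])
    show "T holomorphic_on half_strip" unfolding T_def by (intro holomorphic_intros)
    show "inj_on T half_strip"
    proof (rule inj_onI)
      fix x y assume xy: "x \<in> half_strip" "y \<in> half_strip" "T x = T y"
      hence "exp (-x) = exp (-y)" using wa \<mu> by (simp add: T_def)
      moreover have "\<bar>Im (-x) - Im (-y)\<bar> < 2 * pi" using xy(1,2) pi_gt3 by (auto simp: half_strip_def)
      ultimately have "-x = -y" by (rule exp_complex_eqI[rotated])
      thus "x = y" by simp
    qed
    show "T ` half_strip \<subseteq> ball w \<rho> \<inter> ball a \<delta>"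
    proof clarify
      fix z assume "z \<in> half_strip"
      from T[OF this] \<mu>\<rho> show "T z \<in> ball w \<rho> \<inter> ball a \<delta>" by (simp add: dist_commute)
    qed
    show "0 < c" using m \<open>0 < C\<close> \<mu> \<rho> by (simp add: c_def)
    fix z assume z: "z \<in> half_strip"
    have gT: "1 \<le> cmod (g (T z))"
    proof (rule d(2))
      show "T z \<in> ball w \<rho>" using T[OF z] by blast
      thus "T z \<noteq> a" using \<rho> by auto
      show "dist (T z) a < d" using T(2)[OF z] \<mu>\<rho> by linarith
    qed
    have dT: "dist (T z) a = \<mu> * \<rho> * exp (- Re z)"
      using \<rho> \<mu> by (simp add: T_def dist_norm norm_mult norm_exp_eq_Re)
    have "1 + (cmod (g (T z)))\<^sup>2 \<le> 2 * (cmod (g (T z)))\<^sup>2" using gT by simp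
    hence "(1 + (cmod (g (T z)))\<^sup>2) ^ m \<le> (2 * (cmod (g (T z)))\<^sup>2) ^ m"
      by (rule power_mono) simp
    also have "\<dots> = 2 ^ m * cmod (g (T z)) ^ (2 * m)"
      by (simp add: power_mult_distrib power_mult)
    finally have pw: "(1 + (cmod (g (T z)))\<^sup>2) ^ m \<le> 2 ^ m * cmod (g (T z)) ^ (2 * m)" .
    define k where "k = real m * C * (\<mu> * \<rho>) * 2 ^ m"
    have k: "0 < k" using m \<open>0 < C\<close> \<mu> \<rho> by (simp add: k_def)
    have ck: "c = inverse k" unfolding c_def k_def ..
    have "1 \<le> real m * C * dist (T z) a * (1 + (cmod (g (T z)))\<^sup>2) ^ m"
      using asymptotic_branch_growth[OF as sub m T(1)[OF z]] .
    also have "\<dots> \<le> real m * C * dist (T z) a * (2 ^ m * cmod (g (T z)) ^ (2 * m))"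
      using pw \<open>0 < C\<close> by (intro mult_left_mono) auto
    also have "\<dots> = k * exp (- Re z) * cmod (g (T z)) ^ (2 * m)"
      by (simp add: k_def dT mult_ac)
    finally have "exp (Re z) * 1 \<le> exp (Re z) * (k * exp (- Re z) * cmod (g (T z)) ^ (2 * m))"
      by (intro mult_left_mono) auto
    hence "exp (Re z) \<le> k * cmod (g (T z)) ^ (2 * m)"
      by (simp add: exp_minus field_simps)
    hence "exp (Re z) / k \<le> cmod (g (T z)) ^ (2 * m)" using k by (simp add: pos_divide_le_eq mult.commute)
    thus "c * exp (Re z) \<le> cmod (g (T z)) ^ (2 * m)"
      by (simp add: ck divide_inverse mult.commute)
  qed
qed

text \<open>
  Branches at different points automatically have disjoint images once their sectors have been
  shrunk below half the distance of the points, since \<open>f\<close> recovers the sector from the image. The hypothesis on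
  the images therefore concerns branches at the same point.
\<close>
lemma disjoint_asymptotic_branches_bounded:
  fixes I :: "'i set"
  assumes "finite I" and m: "0 < m" and "0 < C"
    and as: "\<And>i. i \<in> I \<Longrightarrow> asymptotic_branch f (w i) (\<rho> i) (a i) (g i)"
    and sub: "\<And>i. i \<in> I \<Longrightarrow> ball (w i) (\<rho> i) \<subseteq> B"
    and disj: "\<And>i j. i \<in> I \<Longrightarrow> j \<in> I \<Longrightarrow> i \<noteq> j \<Longrightarrow>
       a i \<noteq> a j \<or> g i ` ball (w i) (\<rho> i) \<inter> g j ` ball (w j) (\<rho> j) = {}"
  shows "real (card I) \<le> 442368 * pi * (real m)\<^sup>2"
proof -
  define S where "S = (\<lambda>(i,j). dist (a i) (a j)) ` {(i,j) \<in> I \<times> I. a i \<noteq> a j}"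
  have "finite S" unfolding S_def using \<open>finite I\<close>
    by (intro finite_imageI) (rule finite_subset[of _ "I \<times> I"], auto)
  \<comment> \<open>Inserting \<open>1\<close> keeps the set nonempty when all the points coincide.\<close>
  define \<delta> where "\<delta> = Min (insert 1 S) / 2"
  have "0 < Min (insert 1 S)" using \<open>finite S\<close> by (subst Min_gr_iff) (auto simp: S_def)
  hence "0 < \<delta>" by (simp add: \<delta>_def)
  have far: "2 * \<delta> \<le> dist (a i) (a j)" if "i \<in> I" "j \<in> I" "a i \<noteq> a j" for i j
  proof -
    have "dist (a i) (a j) \<in> insert 1 S" using that by (auto simp: S_def)
    hence "Min (insert 1 S) \<le> dist (a i) (a j)" using \<open>finite S\<close> by (intro Min_le) auto
    thus ?thesis by (simp add: \<delta>_def)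
  qed
  define P where "P i T c \<longleftrightarrow> T holomorphic_on half_strip \<and> inj_on T half_strip
    \<and> T ` half_strip \<subseteq> ball (w i) (\<rho> i) \<inter> ball (a i) \<delta> \<and> 0 < c
    \<and> (\<forall>z\<in>half_strip. c * exp (Re z) \<le> cmod (g i (T z)) ^ (2 * m))" for i T and c :: real
  have "\<exists>T c. P i T c" if "i \<in> I" for i
    using asymptotic_branch_half_strip[OF as[OF that] sub[OF that] m \<open>0 < C\<close> \<open>0 < \<delta>\<close>]
    unfolding P_def by metis
  then obtain T c where "\<And>i. i \<in> I \<Longrightarrow> P i (T i) (c i)" by metis
  note T = this[unfolded P_def]
  have br: "inverse_branch f (ball (w i) (\<rho> i)) (g i)" if "i \<in> I" for i
    using as[OF that] by (simp add: asymptotic_branch_def)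
  have Tin: "T i z \<in> ball (w i) (\<rho> i)" "T i z \<in> ball (a i) \<delta>" if "i \<in> I" "z \<in> half_strip" for i z
    using T[OF that(1)] that(2) by blast+
  have "real (card I) \<le> 110592 * pi * (real (2 * m))\<^sup>2"
  proof (rule disjoint_half_strips_bounded[where G = "\<lambda>i z. g i (T i z)" and c = c and I = I and K = "2 * m"])
    fix i assume i: "i \<in> I"
    have hol: "T i holomorphic_on half_strip" and inj: "inj_on (T i) half_strip" using T[OF i] by auto
    have "(g i \<circ> T i) holomorphic_on half_strip"
      using hol inverse_branchD(1)[OF br[OF i]] by (rule holomorphic_on_compose_gen) (use Tin[OF i] in blast)
    thus "(\<lambda>z. g i (T i z)) holomorphic_on half_strip" by (simp add: o_def)
    have "inj_on (g i \<circ> T i) half_strip"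
      using inj inj_on_subset[OF inverse_branch_inj[OF br[OF i]]] by (rule comp_inj_on) (use Tin[OF i] in blast)
    thus "inj_on (\<lambda>z. g i (T i z)) half_strip" by (simp add: o_def)
    show "0 < c i" using T[OF i] by blast
    fix z assume "z \<in> half_strip"
    thus "c i * exp (Re z) \<le> cmod (g i (T i z)) ^ (2 * m)" using T[OF i] by blast
  next
    show "disjoint_family_on (\<lambda>i. (\<lambda>z. g i (T i z)) ` half_strip) I"
      unfolding disjoint_family_on_def
    proof (intro ballI impI)
      fix i j assume ij: "i \<in> I" "j \<in> I" "i \<noteq> j"
      show "(\<lambda>z. g i (T i z)) ` half_strip \<inter> (\<lambda>z. g j (T j z)) ` half_strip = {}"
      proof (rule ccontr)
        assume "\<not> ?thesis"
        then obtain x y where xy: "x \<in> half_strip" "y \<in> half_strip" "g i (T i x) = g j (T j y)" by blast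
        have "g i (T i x) \<in> g i ` ball (w i) (\<rho> i)" "g j (T j y) \<in> g j ` ball (w j) (\<rho> j)"
          using Tin(1) ij xy by blast+
        hence "g i ` ball (w i) (\<rho> i) \<inter> g j ` ball (w j) (\<rho> j) \<noteq> {}" using xy(3) by auto
        hence "a i \<noteq> a j" using disj[OF ij] by blast
        have "T i x = T j y"
          using inverse_branchD(4)[OF br[OF ij(1)] Tin(1)[OF ij(1) xy(1)]]
            inverse_branchD(4)[OF br[OF ij(2)] Tin(1)[OF ij(2) xy(2)]] xy(3) by simp
        hence "dist (a i) (T i x) < \<delta>" "dist (a j) (T i x) < \<delta>"
          using Tin(2)[OF ij(1) xy(1)] Tin(2)[OF ij(2) xy(2)] by simp_all
        hence "dist (a i) (a j) < 2 * \<delta>" using dist_triangle2[of "a i" "a j" "T i x"] by linarith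
        thus False using far[OF ij(1,2) \<open>a i \<noteq> a j\<close>] by simp
      qed
    qed
  qed (use \<open>finite I\<close> m in auto)
  thus ?thesis by (simp add: power_mult_distrib)
qed

lemma finite_asymptotic_points:
  assumes m: "0 < m" and C: "0 < C"
  shows "finite (asymptotic_points f B)"
proof (rule ccontr)
  assume "infinite (asymptotic_points f B)"
  obtain n :: nat where n: "442368 * pi * (real m)\<^sup>2 < real n" using reals_Archimedean2 by blast
  obtain A where A: "A \<subseteq> asymptotic_points f B" "finite A" "card A = n"
    using \<open>infinite (asymptotic_points f B)\<close> infinite_arbitrarily_large by blast
  have "\<exists>w \<rho> g. ball w \<rho> \<subseteq> B \<and> asymptotic_branch f w \<rho> a g" if "a \<in> A" for a
    using that A(1) by (auto simp: asymptotic_points_def)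
  then obtain w \<rho> g where wg: "\<And>a. a \<in> A \<Longrightarrow> ball (w a) (\<rho> a) \<subseteq> B \<and> asymptotic_branch f (w a) (\<rho> a) a (g a)"
    by metis
  have "real (card A) \<le> 442368 * pi * (real m)\<^sup>2"
    by (rule disjoint_asymptotic_branches_bounded[where w = w and \<rho> = \<rho> and a = "\<lambda>a. a" and g = g])
       (use A m C wg in auto)
  thus False using n A(3) by simp
qed

end

section \<open>The covering of a punctured disc and its logarithmic lifts\<close>

text \<open>
  The situation after shrinking \<open>U\<close> to a disc about \<open>s\<close> that contains no asymptotic point other than
  possibly \<open>s\<close>.
\<close>
locale isolated_asymptotic_value = expanding_over f "ball s r" C m
  for f :: "complex \<Rightarrow> complex" and s :: complex and r C :: real and m :: nat +
  assumes r: "0 < r" and C: "0 < C" and m: "0 < m"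
    and isolated: "asymptotic_points f (ball s r) \<subseteq> {s}"
begin

lemma asymptotic_branch_only_at_center:
  assumes "asymptotic_branch f w \<rho> a g" "\<rho> < R" "ball w R \<subseteq> ball s r"
  shows "a = s"
proof -
  have d: "dist w a = \<rho>" using assms(1) by (simp add: asymptotic_branch_def)
  hence "a \<in> ball s r" using assms(2,3) by auto
  moreover have "ball w \<rho> \<subseteq> ball s r" using assms(2,3) subset_ball[of \<rho> R w] by auto
  ultimately have "a \<in> asymptotic_points f (ball s r)"
    unfolding asymptotic_points_def using assms(1) by blast
  thus ?thesis using isolated by blast
qed

lemma branch_through_center:
  assumes "\<not> is_pole f z" "f z = s"
  obtains g where "inverse_branch f (ball s r) g" "g s = z"
  using maximal_branch[of z r] asymptotic_branch_only_at_center[of s _ _ _ r] assms r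
  by (metis subset_refl)

lemma branch_off_center:
  assumes "\<not> is_pole f z" "0 < R" "ball (f z) R \<subseteq> ball s r - {s}"
  obtains g where "inverse_branch f (ball (f z) R) g" "g (f z) = z"
proof (rule maximal_branch[OF assms(1,2)])
  show "ball (f z) R \<subseteq> ball s r" using assms(3) by blast
  show "\<not> asymptotic_branch f (f z) \<rho> a g" if "\<rho> < R" for \<rho> a g
  proof
    assume as: "asymptotic_branch f (f z) \<rho> a g"
    hence "a = s" using that assms(3) by (intro asymptotic_branch_only_at_center) auto
    moreover have "a \<in> ball (f z) R" using as that by (simp add: asymptotic_branch_def)
    ultimately show False using assms(3) by blast
  qed
qed (rule that)

text \<open>
  For \<open>x\<close> in the punctured disc, the radius of the largest disc about \<open>x\<close> inside the punctured disc.
\<close>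
definition margin :: "complex \<Rightarrow> real" where
  "margin x = min (dist x s) (r - dist x s)"

lemma margin_pos: "x \<in> ball s r - {s} \<Longrightarrow> 0 < margin x"
  by (auto simp: margin_def dist_commute)

lemma ball_margin: "ball x (margin x) \<subseteq> ball s r - {s}"
proof
  fix y assume "y \<in> ball x (margin x)"
  hence y: "dist x y < dist x s" "dist x y < r - dist x s" by (simp_all add: margin_def)
  have "dist s y \<le> dist x s + dist x y" by (metis dist_commute dist_triangle)
  hence "y \<in> ball s r" using y(2) by simp
  moreover have "y \<noteq> s" using y(1) by auto
  ultimately show "y \<in> ball s r - {s}" by simp
qed

text \<open>
  The branch through \<open>z\<close> exists on a disc about \<open>f z\<close> that reaches \<open>x\<close>; restart there to obtain a
  branch on the full disc about \<open>x\<close>.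
\<close>
lemma branch_covers_fibres:
  assumes x: "x \<in> ball s r - {s}" and z: "\<not> is_pole f z" "f z \<in> ball x (margin x / 2)"
  obtains h where "inverse_branch f (ball x (margin x)) h" "h (f z) = z"
proof -
  let ?d = "margin x"
  have d: "0 < ?d" using margin_pos[OF x] .
  have "ball (f z) (?d / 2) \<subseteq> ball x ?d"
  proof
    fix y assume "y \<in> ball (f z) (?d / 2)"
    hence "dist x y < ?d / 2 + ?d / 2"
      using z(2) dist_triangle[of x y "f z"] by simp
    thus "y \<in> ball x ?d" by simp
  qed
  hence sub: "ball (f z) (?d / 2) \<subseteq> ball s r - {s}" using ball_margin[of x] by blast
  obtain g where g: "inverse_branch f (ball (f z) (?d / 2)) g" "g (f z) = z"
    using branch_off_center[OF z(1) _ sub] d by auto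
  have xin: "x \<in> ball (f z) (?d / 2)" using z(2) by (simp add: dist_commute)
  have gx: "\<not> is_pole f (g x)" "f (g x) = x" using inverse_branchD(3,4)[OF g(1) xin] .
  obtain h where h: "inverse_branch f (ball x ?d) h" "h x = g x"
    using branch_off_center[OF gx(1) d] ball_margin[of x] unfolding gx(2) by metis
  have "g (f z) = h (f z)"
  proof (rule branches_agree[OF g(1) h(1), of "ball (f z) (?d / 2) \<inter> ball x ?d" x])
    show "connected (ball (f z) (?d / 2) \<inter> ball x ?d)" by (intro convex_connected convex_Int convex_ball)
    show "ball (f z) (?d / 2) \<subseteq> ball s r" using sub by blast
    show "x \<in> ball (f z) (?d / 2) \<inter> ball x ?d" using xin d by simp
    show "f z \<in> ball (f z) (?d / 2) \<inter> ball x ?d" using z(2) d by simp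
  qed (use h(2) in auto)
  with g(2) h(1) show ?thesis using that by simp
qed

lemma image_of_punctured_preimage:
  assumes ne: "finite_preimage f (ball s r - {s}) \<noteq> {}"
  shows "f ` finite_preimage f (ball s r - {s}) = ball s r - {s}"
proof -
  let ?P = "ball s r - {s}"
  define I where "I = f ` finite_preimage f ?P"
  have IP: "I \<subseteq> ?P" by (auto simp: I_def finite_preimage_def)
  have fill: "ball x (margin x) \<subseteq> I" if x: "x \<in> ?P" "ball x (margin x / 2) \<inter> I \<noteq> {}" for x
  proof
    fix y assume y: "y \<in> ball x (margin x)"
    obtain z where z: "\<not> is_pole f z" "f z \<in> ball x (margin x / 2)"
      using x(2) by (auto simp: I_def finite_preimage_def)
    obtain h where h: "inverse_branch f (ball x (margin x)) h" using branch_covers_fibres[OF x(1) z] .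
    have "h y \<in> finite_preimage f ?P"
      using inverse_branchD(3,4)[OF h y] ball_margin[of x] y by (auto simp: finite_preimage_def)
    moreover have "f (h y) = y" using inverse_branchD(4)[OF h y] .
    ultimately show "y \<in> I" unfolding I_def by (metis imageI)
  qed
  have "open I"
  proof (rule openI)
    fix x assume x: "x \<in> I"
    hence xP: "x \<in> ?P" using IP by blast
    hence "x \<in> ball x (margin x / 2) \<inter> I" using x margin_pos[OF xP] by simp
    thus "\<exists>e>0. ball x e \<subseteq> I" using fill[OF xP] margin_pos[OF xP] by blast
  qed
  moreover have "open (?P - I)"
  proof (rule openI)
    fix x assume x: "x \<in> ?P - I"
    have d: "0 < margin x" using margin_pos x by blast
    have "ball x (margin x / 2) \<inter> I = {}" using fill[of x] x d by force
    moreover have "ball x (margin x / 2) \<subseteq> ?P" using ball_margin[of x] d subset_ball[of "margin x / 2" "margin x" x] by auto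
    ultimately have "ball x (margin x / 2) \<subseteq> ?P - I" by blast
    thus "\<exists>e>0. ball x e \<subseteq> ?P - I" using d by (intro exI[of _ "margin x / 2"]) simp
  qed
  moreover have "connected ?P" by (rule connected_punctured_ball) simp
  ultimately have "I \<inter> ?P = {} \<or> (?P - I) \<inter> ?P = {}"
    by (intro connectedD) blast+
  moreover have "I \<noteq> {}" using ne by (simp add: I_def)
  ultimately show ?thesis using IP unfolding I_def by blast
qed

text \<open>
  The disc of half the margin is evenly covered; its sheets are its images under the
  branches on the disc of full margin.
\<close>
lemma covering_punctured_disc:
  assumes ne: "finite_preimage f (ball s r - {s}) \<noteq> {}"
  shows "covering_space (finite_preimage f (ball s r - {s})) f (ball s r - {s})"
proof
  let ?P = "ball s r - {s}" and ?C = "finite_preimage f (ball s r - {s})"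
  have C: "?C \<subseteq> {z. \<not> is_pole f z}" by (auto simp: finite_preimage_def)
  show "continuous_on ?C f"
    using holomorphic_on_imp_continuous_on[OF holomorphic_off_poles] C by (rule continuous_on_subset)
  show "f ` ?C = ?P" using ne by (rule image_of_punctured_preimage)
  have opP: "open ?P" by (intro open_Diff open_ball closed_singleton)
  have opC: "open ?C" by (rule open_finite_preimage[OF opP])
  fix x assume x: "x \<in> ?P"
  define T where "T = ball x (margin x / 2)"
  define V where "V = {h ` T | h. inverse_branch f (ball x (margin x)) h}"
  have d: "0 < margin x" using margin_pos[OF x] .
  have Tsub: "T \<subseteq> ball x (margin x)" unfolding T_def using d by (intro subset_ball) simp
  have TP: "T \<subseteq> ?P" using Tsub ball_margin[of x] by blast
  have brT: "inverse_branch f T h" if "inverse_branch f (ball x (margin x)) h" for h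
    using that Tsub by (rule inverse_branch_subset)
  have "x \<in> T" using d by (simp add: T_def)
  moreover have "openin (top_of_set ?P) T" using TP by (intro open_subset) (simp_all add: T_def)
  moreover have "\<Union>V = ?C \<inter> f -` T"
  proof
    show "\<Union>V \<subseteq> ?C \<inter> f -` T"
    proof
      fix z assume "z \<in> \<Union>V"
      then obtain h y where h: "inverse_branch f (ball x (margin x)) h" "y \<in> T" "z = h y" unfolding V_def by blast
      have "\<not> is_pole f z" "f z = y" using inverse_branchD(3,4)[OF brT[OF h(1)] h(2)] h(3) by simp_all
      thus "z \<in> ?C \<inter> f -` T" using h(2) TP by (auto simp: finite_preimage_def)
    qed
    show "?C \<inter> f -` T \<subseteq> \<Union>V"
    proof
      fix z assume z: "z \<in> ?C \<inter> f -` T"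
      hence "\<not> is_pole f z" "f z \<in> ball x (margin x / 2)" by (auto simp: finite_preimage_def T_def)
      then obtain h where h: "inverse_branch f (ball x (margin x)) h" "h (f z) = z"
        using branch_covers_fibres[OF x] by metis
      have "z \<in> h ` T" using z h(2) by (metis IntD2 image_eqI vimageD)
      thus "z \<in> \<Union>V" using h(1) unfolding V_def by blast
    qed
  qed
  moreover have "openin (top_of_set ?C) u" if u: "u \<in> V" for u
  proof -
    obtain h where h: "inverse_branch f (ball x (margin x)) h" "u = h ` T" using u unfolding V_def by blast
    have "open u" unfolding h(2)
      using inverse_branchD(1)[OF brT[OF h(1)]] _ inverse_branch_inj[OF brT[OF h(1)]]
      by (rule open_mapping_thm3) (simp add: T_def)
    moreover have "u \<subseteq> ?C"
      unfolding h(2) using inverse_branch_in_preimage[OF brT[OF h(1)] TP] by blast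
    ultimately show ?thesis by (intro open_subset)
  qed
  moreover have "pairwise disjnt V"
  proof (rule pairwiseI)
    fix u v assume uv: "u \<in> V" "v \<in> V" "u \<noteq> v"
    obtain h where h: "inverse_branch f (ball x (margin x)) h" "u = h ` T" using uv(1) unfolding V_def by blast
    obtain k where k: "inverse_branch f (ball x (margin x)) k" "v = k ` T" using uv(2) unfolding V_def by blast
    show "disjnt u v"
    proof (rule ccontr)
      assume "\<not> disjnt u v"
      then obtain p q where pq: "p \<in> T" "q \<in> T" "h p = k q" unfolding disjnt_def h(2) k(2) by blast
      have "p = q" using inverse_branchD(4)[OF brT[OF h(1)] pq(1)] inverse_branchD(4)[OF brT[OF k(1)] pq(2)] pq(3) by simp
      have "h y = k y" if "y \<in> T" for y
      proof (rule branches_agree[OF brT[OF h(1)] brT[OF k(1)], of T p])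
        show "connected T" by (simp add: T_def)
        show "T \<subseteq> ball s r" using TP by blast
      qed (use pq \<open>p = q\<close> that in auto)
      hence "u = v" unfolding h(2) k(2) by (rule image_cong[OF refl])
      thus False using uv(3) by simp
    qed
  qed
  moreover have "\<exists>q. homeomorphism u T f q" if u: "u \<in> V" for u
  proof -
    obtain h where h: "inverse_branch f (ball x (margin x)) h" "u = h ` T" using u unfolding V_def by blast
    note b = inverse_branchD[OF brT[OF h(1)]]
    have "homeomorphism T u h f"
    proof (rule homeomorphismI)
      show "continuous_on T h" by (rule b(2))
      show "continuous_on u f"
      proof (rule continuous_on_subset[OF holomorphic_on_imp_continuous_on[OF holomorphic_off_poles]])
        show "u \<subseteq> {z. \<not> is_pole f z}" unfolding h(2) using b(3) by blast
      qed
    qed (use b(4) in \<open>auto simp: h(2)\<close>)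
    thus ?thesis using homeomorphism_symD by blast
  qed
  ultimately show "\<exists>T. x \<in> T \<and> openin (top_of_set ?P) T \<and> (\<exists>v. \<Union>v = ?C \<inter> f -` T \<and>
      (\<forall>u\<in>v. openin (top_of_set ?C) u) \<and> pairwise disjnt v \<and> (\<forall>u\<in>v. \<exists>q. homeomorphism u T f q))"
    by (intro exI[of _ T] conjI exI[of _ V] ballI)
qed

abbreviation (input) half_plane :: "complex set" where
  "half_plane \<equiv> {\<zeta>. Re \<zeta> < ln r}"

definition log_lift :: "(complex \<Rightarrow> complex) \<Rightarrow> bool" where
  "log_lift G \<longleftrightarrow> G holomorphic_on half_plane \<and>
     (\<forall>\<zeta>\<in>half_plane. \<not> is_pole f (G \<zeta>) \<and> f (G \<zeta>) = s + exp \<zeta>)"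

lemma convex_half_plane: "convex half_plane" by (rule convex_halfspace_Re_lt)

lemma exp_in_disc: "\<zeta> \<in> half_plane \<Longrightarrow> s + exp \<zeta> \<in> ball s r - {s}"
proof -
  assume "\<zeta> \<in> half_plane"
  hence "exp (Re \<zeta>) < exp (ln r)" by simp
  thus ?thesis using r by (simp add: dist_norm)
qed

text \<open>
  The half-plane is simply connected, so the exponential lifts through the covering.
\<close>
lemma log_lift_exists:
  assumes z: "z \<in> finite_preimage f (ball s r - {s})"
  obtains G \<zeta> where "log_lift G" "\<zeta> \<in> half_plane" "G \<zeta> = z"
proof -
  let ?P = "ball s r - {s}" and ?C = "finite_preimage f (ball s r - {s})"
  have cov: "covering_space ?C f ?P" using z by (intro covering_punctured_disc) blast
  define \<zeta> where "\<zeta> = Ln (f z - s)"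
  have fz: "f z - s \<noteq> 0" "cmod (f z - s) < r"
    using z by (auto simp: finite_preimage_def dist_norm norm_minus_commute)
  have \<zeta>: "\<zeta> \<in> half_plane" using fz r by (simp add: \<zeta>_def)
  have hol: "(\<lambda>\<zeta>. s + exp \<zeta>) holomorphic_on half_plane" by (intro holomorphic_intros)
  have im: "(\<lambda>\<zeta>. s + exp \<zeta>) \<in> half_plane \<rightarrow> ?P" using exp_in_disc by blast
  obtain G where G: "continuous_on half_plane G" "G \<in> half_plane \<rightarrow> ?C" "G \<zeta> = z"
    "\<And>y. y \<in> half_plane \<Longrightarrow> f (G y) = s + exp y"
  proof (rule covering_space_lift_strong[OF cov z \<zeta>, of "\<lambda>\<zeta>. s + exp \<zeta>"])
    show "simply_connected half_plane" by (rule convex_imp_simply_connected[OF convex_half_plane])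
    show "locally path_connected half_plane" by (rule convex_imp_locally_path_connected[OF convex_half_plane])
    show "continuous_on half_plane (\<lambda>\<zeta>. s + exp \<zeta>)" by (intro continuous_intros)
    show "s + exp \<zeta> = f z" using fz(1) by (simp add: \<zeta>_def)
  qed (use im in auto)
  have opC: "open ?C" by (rule open_finite_preimage) (intro open_Diff open_ball closed_singleton)
  have "f holomorphic_on ?C"
    using holomorphic_off_poles by (rule holomorphic_on_subset) (auto simp: finite_preimage_def)
  hence "G holomorphic_on half_plane"
    by (rule covering_space_lift_is_holomorphic[OF cov opC _ hol im G(2,1,4)])
  hence "log_lift G" using G(2,4) by (auto simp: log_lift_def finite_preimage_def)
  with \<zeta> G(3) show ?thesis using that by blast
qed

end

section \<open>Logarithmic lifts near the centre\<close>

context isolated_asymptotic_value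
begin

text \<open>
  The inverse branch that \<open>G\<close> induces on the disc of radius \<open>r/2\<close> that touches \<open>s\<close> from the direction \<open>\<theta>\<close>.
  The angle \<open>\<theta>\<close> is any real number: values that differ by \<open>2\<pi>\<close> give the same disc but in general
  different branches.
\<close>
definition log_branch :: "(complex \<Rightarrow> complex) \<Rightarrow> real \<Rightarrow> complex \<Rightarrow> complex" where
  "log_branch G \<theta> w = G (\<i> * of_real \<theta> + Ln ((w - s) * cis (-\<theta>)))"

definition tangent_center :: "real \<Rightarrow> complex" where
  "tangent_center \<theta> = s + of_real (r / 2) * cis \<theta>"

lemma dist_tangent_center: "dist (tangent_center \<theta>) s = r / 2"
  using r by (simp add: tangent_center_def dist_norm norm_mult)

lemma tangent_disc_subset: "ball (tangent_center \<theta>) (r / 2) \<subseteq> ball s r - {s}"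
proof
  fix w assume w: "w \<in> ball (tangent_center \<theta>) (r / 2)"
  have "dist s w \<le> dist s (tangent_center \<theta>) + dist (tangent_center \<theta>) w" by (rule dist_triangle)
  hence "dist s w < r" using w dist_tangent_center[of \<theta>] by (simp add: dist_commute)
  moreover have "w \<noteq> s" using w dist_tangent_center[of \<theta>] by auto
  ultimately show "w \<in> ball s r - {s}" by simp
qed

lemma mem_tangent_disc:
  "w \<in> ball (tangent_center \<theta>) (r / 2) \<longleftrightarrow> cmod ((w - s) * cis (-\<theta>) - of_real (r / 2)) < r / 2"
proof -
  have "(w - s) * cis (-\<theta>) - of_real (r / 2) = (w - tangent_center \<theta>) * cis (-\<theta>)"
    by (simp add: tangent_center_def algebra_simps cis_mult)
  hence "cmod ((w - s) * cis (-\<theta>) - of_real (r / 2)) = cmod (w - tangent_center \<theta>)"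
    by (simp add: norm_mult)
  thus ?thesis by (simp add: dist_norm norm_minus_commute)
qed

lemma tangent_disc_right_half_plane:
  assumes "w \<in> ball (tangent_center \<theta>) (r / 2)"
  shows "0 < Re ((w - s) * cis (-\<theta>))"
proof -
  have "\<bar>Re ((w - s) * cis (-\<theta>) - of_real (r / 2))\<bar> < r / 2"
    using assms abs_Re_le_cmod le_less_trans unfolding mem_tangent_disc by blast
  moreover have "Re ((w - s) * cis (-\<theta>) - of_real (r / 2)) = Re ((w - s) * cis (-\<theta>)) - r / 2" by simp
  ultimately show ?thesis by linarith
qed

lemma log_branch_argument:
  assumes w: "w \<in> ball (tangent_center \<theta>) (r / 2)"
  defines "\<zeta> \<equiv> \<i> * of_real \<theta> + Ln ((w - s) * cis (-\<theta>))"
  shows "\<zeta> \<in> half_plane" "s + exp \<zeta> = w"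
proof -
  let ?v = "(w - s) * cis (-\<theta>)"
  have ws: "w - s \<noteq> 0" "cmod (w - s) < r"
    using subsetD[OF tangent_disc_subset w] by (auto simp: dist_norm norm_minus_commute)
  have v: "?v \<noteq> 0" "cmod ?v = cmod (w - s)" using ws(1) by (simp_all add: norm_mult)
  have "Re \<zeta> = ln (cmod (w - s))" using v by (simp add: \<zeta>_def)
  thus "\<zeta> \<in> half_plane" using ws r by simp
  have "exp \<zeta> = cis \<theta> * ?v" using v(1) by (simp add: \<zeta>_def exp_add cis_conv_exp)
  also have "\<dots> = w - s" by (simp add: mult.left_commute[of "cis \<theta>"] cis_mult)
  finally show "s + exp \<zeta> = w" by simp
qed

lemma log_branch_inverse:
  assumes G: "log_lift G"
  shows "inverse_branch f (ball (tangent_center \<theta>) (r / 2)) (log_branch G \<theta>)"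
proof -
  let ?D = "ball (tangent_center \<theta>) (r / 2)"
  have "(\<lambda>w. \<i> * of_real \<theta> + Ln ((w - s) * cis (-\<theta>))) holomorphic_on ?D"
  proof (intro holomorphic_intros)
    fix w assume "w \<in> ?D"
    hence "0 < Re ((w - s) * cis (-\<theta>))" by (rule tangent_disc_right_half_plane)
    thus "(w - s) * cis (-\<theta>) \<notin> \<real>\<^sub>\<le>\<^sub>0" by (metis complex_nonpos_Reals_iff not_le)
  qed
  moreover have "G holomorphic_on half_plane" using G by (simp add: log_lift_def)
  ultimately have "(G \<circ> (\<lambda>w. \<i> * of_real \<theta> + Ln ((w - s) * cis (-\<theta>)))) holomorphic_on ?D"
    by (rule holomorphic_on_compose_gen) (use log_branch_argument(1) in blast)
  moreover have "G \<circ> (\<lambda>w. \<i> * of_real \<theta> + Ln ((w - s) * cis (-\<theta>))) = log_branch G \<theta>"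
    by (rule ext) (simp add: log_branch_def)
  ultimately show ?thesis
    using G log_branch_argument unfolding inverse_branch_def log_lift_def log_branch_def by metis
qed

text \<open>
  Close to \<open>s\<close> the touching disc contains a sector of half-angle \<open>1\<close>, so finitely many of them surround
  \<open>s\<close> as often as needed.
\<close>
lemma log_branch_exp:
  assumes "\<bar>Im \<zeta> - \<theta>\<bar> < 1" and "Re \<zeta> < ln (r / 2)"
  shows "s + exp \<zeta> \<in> ball (tangent_center \<theta>) (r / 2)" "log_branch G \<theta> (s + exp \<zeta>) = G \<zeta>"
proof -
  define \<xi> where "\<xi> = \<zeta> - \<i> * of_real \<theta>"
  have v: "exp \<zeta> * cis (-\<theta>) = exp \<xi>" by (simp add: \<xi>_def exp_diff cis_conv_exp exp_minus divide_inverse)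
  define e where "e = exp (Re \<xi>)"
  have "exp (Re \<zeta>) < exp (ln (r / 2))" using assms(2) by simp
  hence e: "0 < e" "e < r / 2" using r by (simp_all add: e_def \<xi>_def)
  have "1/2 < cos (Im \<xi>)" using assms(1) by (intro cos_gt_half_near_zero) (simp add: \<xi>_def)
  hence "e * (1/2) < e * cos (Im \<xi>)" using e by (intro mult_strict_left_mono)
  hence Re: "e / 2 < Re (exp \<xi>)" by (simp add: e_def Re_exp)
  have "(cmod (exp \<xi> - of_real (r / 2)))\<^sup>2 = (cmod (exp \<xi>))\<^sup>2 - r * Re (exp \<xi>) + (r / 2)\<^sup>2"
    unfolding cmod_power2 by (simp add: power2_eq_square algebra_simps)
  moreover have "(cmod (exp \<xi>))\<^sup>2 = e * e" by (simp add: e_def power2_eq_square)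
  moreover have "e * e < r / 2 * e" using e by (intro mult_strict_right_mono)
  moreover have "r * (e / 2) < r * Re (exp \<xi>)" using Re r by (intro mult_strict_left_mono)
  ultimately have "(cmod (exp \<xi> - of_real (r / 2)))\<^sup>2 < (r / 2)\<^sup>2" by linarith
  hence "cmod (exp \<xi> - of_real (r / 2)) < r / 2" by (rule power_less_imp_less_base) (use r in simp)
  thus "s + exp \<zeta> \<in> ball (tangent_center \<theta>) (r / 2)" unfolding mem_tangent_disc by (simp add: v)
  have "Ln (exp \<xi>) = \<xi>" using assms(1) pi_gt3 by (intro Ln_exp) (auto simp: \<xi>_def)
  thus "log_branch G \<theta> (s + exp \<zeta>) = G \<zeta>" by (simp add: log_branch_def v) (simp add: \<xi>_def)
qed

lemma log_lifts_agree:
  assumes G: "log_lift G" and H: "continuous_on half_plane H" "\<And>\<zeta>. \<zeta> \<in> half_plane \<Longrightarrow> f (H \<zeta>) = s + exp \<zeta>"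
    and "\<zeta>0 \<in> half_plane" "G \<zeta>0 = H \<zeta>0" "\<zeta> \<in> half_plane"
  shows "G \<zeta> = H \<zeta>"
proof -
  have conn: "connected half_plane" using convex_half_plane by (rule convex_connected)
  have cont: "continuous_on half_plane G"
    using G holomorphic_on_imp_continuous_on by (simp add: log_lift_def)
  have pre: "G \<zeta> \<in> finite_preimage f (ball s r)" if "\<zeta> \<in> half_plane" for \<zeta>
    using G exp_in_disc[OF that] that by (simp add: log_lift_def finite_preimage_def)
  have eq: "f (G \<zeta>) = f (H \<zeta>)" if "\<zeta> \<in> half_plane" for \<zeta>
    using G H(2)[OF that] that by (simp add: log_lift_def)
  show ?thesis by (rule lifts_agree[OF conn cont H(1) pre eq assms(4-6)])
qed

text \<open>
  A branch that extends over \<open>s\<close> extends to the whole disc, as there is no other asymptotic point.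
  By uniqueness of lifts, \<open>G\<close> factors through this extension.
\<close>
lemma log_lift_extends_over_center:
  assumes G: "log_lift G" and no: "\<not> filterlim (log_branch G \<theta>) at_infinity (at s within ball (tangent_center \<theta>) (r / 2))"
  obtains K where "inverse_branch f (ball s r) K" "\<And>\<zeta>. \<zeta> \<in> half_plane \<Longrightarrow> G \<zeta> = K (s + exp \<zeta>)"
proof -
  let ?D = "ball (tangent_center \<theta>) (r / 2)"
  have D: "?D \<subseteq> ball s r" using tangent_disc_subset by blast
  obtain \<epsilon> k where k: "0 < \<epsilon>" "ball s \<epsilon> \<subseteq> ball s r" "inverse_branch f (ball s \<epsilon>) k"
    "\<And>x. x \<in> ball s \<epsilon> \<inter> ?D \<Longrightarrow> k x = log_branch G \<theta> x"
    using branch_extends_or_tends_to_infinity[OF log_branch_inverse[OF G] D dist_tangent_center _ no] r by auto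
  have s\<epsilon>: "s \<in> ball s \<epsilon>" using k(1) by simp
  obtain K where K: "inverse_branch f (ball s r) K" "K s = k s"
    using branch_through_center[OF inverse_branchD(3,4)[OF k(3) s\<epsilon>]] .
  have Kk: "k x = K x" if "x \<in> ball s \<epsilon>" for x
    by (rule branches_agree[OF k(3) K(1), of "ball s \<epsilon>" s]) (use k(1,2) K(2) that in auto)
  define x where "x = min (ln (r / 2)) (ln \<epsilon>) - 1"
  define \<zeta>0 where "\<zeta>0 = Complex x \<theta>"
  have x: "x < ln (r / 2)" "x < ln \<epsilon>" by (simp_all add: x_def)
  have ln2: "ln (r / 2) < ln r" using r by simp
  have \<zeta>0: "\<zeta>0 \<in> half_plane" using x(1) ln2 by (simp add: \<zeta>0_def)
  have "exp x < exp (ln \<epsilon>)" using x(2) by simp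
  hence "s + exp \<zeta>0 \<in> ball s \<epsilon>" using k(1) by (simp add: dist_norm \<zeta>0_def)
  moreover have "s + exp \<zeta>0 \<in> ?D" "log_branch G \<theta> (s + exp \<zeta>0) = G \<zeta>0"
    using log_branch_exp(1)[of \<zeta>0 \<theta>] log_branch_exp(2)[of \<zeta>0 \<theta> G] x(1) by (simp_all add: \<zeta>0_def)
  ultimately have start: "G \<zeta>0 = K (s + exp \<zeta>0)" using k(4) Kk by (metis IntI)
  have im: "s + exp \<zeta> \<in> ball s r" if "\<zeta> \<in> half_plane" for \<zeta> using exp_in_disc[OF that] by blast
  have cont: "continuous_on half_plane (\<lambda>\<zeta>. K (s + exp \<zeta>))"
    by (rule continuous_on_compose2[OF inverse_branchD(2)[OF K(1)]]) (use im in \<open>auto intro!: continuous_intros\<close>)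
  have "G \<zeta> = K (s + exp \<zeta>)" if "\<zeta> \<in> half_plane" for \<zeta>
    by (rule log_lifts_agree[OF G cont _ \<zeta>0 start that]) (rule inverse_branchD(4)[OF K(1) im])
  with K(1) show ?thesis using that by blast
qed

text \<open>
  For injective \<open>G\<close> the branches with \<open>\<theta> = 2\<pi>j\<close> live on one disc and have disjoint images; there are more
  of them than the count allows.
\<close>
lemma log_lift_not_injective:
  assumes G: "log_lift G"
    and lim: "\<And>\<theta>. filterlim (log_branch G \<theta>) at_infinity (at s within ball (tangent_center \<theta>) (r / 2))"
  shows "\<not> inj_on G half_plane"
proof
  assume inj: "inj_on G half_plane"
  obtain n :: nat where n: "442368 * pi * (real m)\<^sup>2 < real n" using reals_Archimedean2 by blast
  define \<theta> where "\<theta> j = 2 * pi * real j" for j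
  have "real (card {..<n}) \<le> 442368 * pi * (real m)\<^sup>2"
  proof (rule disjoint_asymptotic_branches_bounded[where w = "\<lambda>j. tangent_center (\<theta> j)" and \<rho> = "\<lambda>j. r / 2"
        and a = "\<lambda>j. s" and g = "\<lambda>j. log_branch G (\<theta> j)"])
    show "asymptotic_branch f (tangent_center (\<theta> j)) (r / 2) s (log_branch G (\<theta> j))" for j
      using r dist_tangent_center log_branch_inverse[OF G] lim by (simp add: asymptotic_branch_def)
    show "ball (tangent_center (\<theta> j)) (r / 2) \<subseteq> ball s r" for j using tangent_disc_subset by blast
    fix i j assume ij: "i \<in> {..<n}" "j \<in> {..<n}" "i \<noteq> j"
    have "log_branch G (\<theta> i) ` ball (tangent_center (\<theta> i)) (r / 2)
        \<inter> log_branch G (\<theta> j) ` ball (tangent_center (\<theta> j)) (r / 2) = {}"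
    proof (rule ccontr)
      assume "\<not> ?thesis"
      then obtain x y where x: "x \<in> ball (tangent_center (\<theta> i)) (r / 2)"
        and y: "y \<in> ball (tangent_center (\<theta> j)) (r / 2)"
        and eq: "log_branch G (\<theta> i) x = log_branch G (\<theta> j) y" by blast
      have "\<i> * of_real (\<theta> i) + Ln ((x - s) * cis (- \<theta> i)) = \<i> * of_real (\<theta> j) + Ln ((y - s) * cis (- \<theta> j))"
        by (rule inj_onD[OF inj eq[unfolded log_branch_def] log_branch_argument(1)[OF x] log_branch_argument(1)[OF y]])
      hence "\<theta> i + Im (Ln ((x - s) * cis (- \<theta> i))) = \<theta> j + Im (Ln ((y - s) * cis (- \<theta> j)))"
        by (auto simp: complex_eq_iff)
      moreover have "\<bar>Im (Ln ((x - s) * cis (- \<theta> i)))\<bar> < pi" "\<bar>Im (Ln ((y - s) * cis (- \<theta> j)))\<bar> < pi"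
        using Re_Ln_pos_lt_imp[OF tangent_disc_right_half_plane[OF x]]
          Re_Ln_pos_lt_imp[OF tangent_disc_right_half_plane[OF y]] pi_gt_zero by linarith+
      ultimately have "\<bar>\<theta> i - \<theta> j\<bar> < 2 * pi" by linarith
      moreover have "\<bar>\<theta> i - \<theta> j\<bar> = 2 * pi * \<bar>real i - real j\<bar>"
        by (simp add: \<theta>_def abs_mult flip: right_diff_distrib)
      ultimately have "\<bar>real i - real j\<bar> < 1" by simp
      thus False using ij(3) by linarith
    qed
    thus "s \<noteq> s \<or> log_branch G (\<theta> i) ` ball (tangent_center (\<theta> i)) (r / 2)
        \<inter> log_branch G (\<theta> j) ` ball (tangent_center (\<theta> j)) (r / 2) = {}" by blast
  qed (use m C in auto)
  thus False using n by simp
qed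

text \<open>
  A horizontal strip of finite height is covered by finitely many strips \<open>|Im \<zeta> - \<theta>| < 1\<close>, on each of which
  \<open>G\<close> is a single \<open>log_branch\<close>.
\<close>
lemma log_lift_uniformly_large:
  assumes lim: "\<And>\<theta>. filterlim (log_branch G \<theta>) at_infinity (at s within ball (tangent_center \<theta>) (r / 2))"
  obtains c where "\<And>\<zeta>. 0 \<le> Im \<zeta> \<Longrightarrow> Im \<zeta> \<le> L \<Longrightarrow> Re \<zeta> \<le> c \<Longrightarrow> K < cmod (G \<zeta>)"
proof -
  have "\<exists>c. \<forall>\<zeta>. \<bar>Im \<zeta> - \<theta>\<bar> < 1 \<longrightarrow> Re \<zeta> \<le> c \<longrightarrow> K < cmod (G \<zeta>)" for \<theta>
  proof -
    have "eventually (\<lambda>w. max K 0 + 1 \<le> cmod (log_branch G \<theta> w)) (at s within ball (tangent_center \<theta>) (r / 2))"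
      using lim[of \<theta>] by (simp add: filterlim_at_infinity[OF order.refl])
    then obtain d where d: "0 < d" "\<And>w. w \<in> ball (tangent_center \<theta>) (r / 2) \<Longrightarrow> w \<noteq> s \<Longrightarrow> dist w s < d \<Longrightarrow>
        max K 0 + 1 \<le> cmod (log_branch G \<theta> w)"
      unfolding eventually_at by blast
    define c where "c = min (ln (r / 2)) (ln d) - 1"
    have "K < cmod (G \<zeta>)" if \<zeta>: "\<bar>Im \<zeta> - \<theta>\<bar> < 1" "Re \<zeta> \<le> c" for \<zeta>
    proof -
      have c: "Re \<zeta> < ln (r / 2)" "Re \<zeta> < ln d" using \<zeta>(2) by (simp_all add: c_def)
      have "exp (Re \<zeta>) < exp (ln d)" using c(2) by simp
      hence "dist (s + exp \<zeta>) s < d" using d(1) by (simp add: dist_norm)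
      with d(2)[OF log_branch_exp(1)[OF \<zeta>(1) c(1)]]
      have "max K 0 + 1 \<le> cmod (log_branch G \<theta> (s + exp \<zeta>))" by simp
      thus ?thesis unfolding log_branch_exp(2)[OF \<zeta>(1) c(1)] by linarith
    qed
    thus ?thesis by blast
  qed
  then obtain c where c: "\<And>\<theta> \<zeta>. \<bar>Im \<zeta> - \<theta>\<bar> < 1 \<Longrightarrow> Re \<zeta> \<le> c \<theta> \<Longrightarrow> K < cmod (G \<zeta>)" by metis
  define S where "S = (\<lambda>n::nat. c (real n)) ` {..nat \<lfloor>L\<rfloor>}"
  have S: "finite S" by (simp add: S_def)
  have "K < cmod (G \<zeta>)" if \<zeta>: "0 \<le> Im \<zeta>" "Im \<zeta> \<le> L" "Re \<zeta> \<le> Min S" for \<zeta>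
  proof -
    define n where "n = nat \<lfloor>Im \<zeta>\<rfloor>"
    have "n \<le> nat \<lfloor>L\<rfloor>" unfolding n_def using \<zeta>(2) by (intro nat_mono floor_mono)
    hence "c (real n) \<in> S" by (simp add: S_def)
    hence "Min S \<le> c (real n)" using S by (intro Min_le)
    moreover have "\<bar>Im \<zeta> - real n\<bar> < 1" unfolding n_def using \<zeta>(1) by linarith
    ultimately show ?thesis using c[of \<zeta> "real n"] \<zeta>(3) by linarith
  qed
  thus ?thesis using that by blast
qed

end

section \<open>Periodic lifts and regular values\<close>

context isolated_asymptotic_value
begin

lemma log_lift_int_period:
  assumes per: "\<And>\<zeta>. \<zeta> \<in> half_plane \<Longrightarrow> G (\<zeta> + \<i> * of_real p) = G \<zeta>" and "\<zeta> \<in> half_plane"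
  shows "G (\<zeta> + \<i> * of_real (of_int k * p)) = G \<zeta>"
proof -
  have nat: "G (\<zeta> + \<i> * of_real (real n * p)) = G \<zeta>" if "\<zeta> \<in> half_plane" for \<zeta> n
  proof (induction n)
    case (Suc n)
    have "G (\<zeta> + \<i> * of_real (real n * p) + \<i> * of_real p) = G (\<zeta> + \<i> * of_real (real n * p))"
      using that by (intro per) simp
    thus ?case using Suc.IH by (simp add: algebra_simps)
  qed simp
  show ?thesis
  proof (cases "0 \<le> k")
    case True
    thus ?thesis using nat[OF assms(2), of "nat k"] by simp
  next
    case False
    have "G (\<zeta> + \<i> * of_real (of_int k * p) + \<i> * of_real (real (nat (-k)) * p)) = G (\<zeta> + \<i> * of_real (of_int k * p))"
      using assms(2) by (intro nat) simp
    moreover have "\<zeta> + \<i> * of_real (of_int k * p) + \<i> * of_real (real (nat (-k)) * p) = \<zeta>"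
      using False by (simp add: algebra_simps)
    ultimately show ?thesis by metis
  qed
qed

text \<open>
  Let \<open>Y\<close> be the image of a slightly smaller half-plane. Modulo the period, its edge is a compact
  segment, and further left \<open>G\<close> is large. So outside the disc that contains the image of the edge, the
  set \<open>Y\<close> is closed as well as open, and the exterior of a disc is connected.
\<close>
lemma periodic_log_lift_fills_neighbourhood_of_infinity:
  assumes G: "log_lift G"
    and lim: "\<And>\<theta>. filterlim (log_branch G \<theta>) at_infinity (at s within ball (tangent_center \<theta>) (r / 2))"
    and p: "0 < p" and per: "\<And>\<zeta>. \<zeta> \<in> half_plane \<Longrightarrow> G (\<zeta> + \<i> * of_real p) = G \<zeta>"
  obtains M where "\<And>z. M < cmod z \<Longrightarrow> z \<in> G ` half_plane"
proof -
  \<comment> \<open>Any abscissa strictly inside the half-plane would do.\<close>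
  define c where "c = ln r - 1"
  define Y where "Y = G ` {\<zeta>. Re \<zeta> < c}"
  have c_sub: "\<zeta> \<in> half_plane" if "Re \<zeta> \<le> c" for \<zeta> using that by (simp add: c_def)
  have hol: "G holomorphic_on half_plane" using G by (simp add: log_lift_def)
  have cont: "continuous_on half_plane G" using hol by (rule holomorphic_on_imp_continuous_on)
  have fG: "f (G \<zeta>) = s + exp \<zeta>" if "\<zeta> \<in> half_plane" for \<zeta> using G that by (simp add: log_lift_def)
  have reduce: "\<exists>\<xi>. Re \<xi> = Re \<zeta> \<and> 0 \<le> Im \<xi> \<and> Im \<xi> \<le> p \<and> G \<xi> = G \<zeta>" if \<zeta>: "\<zeta> \<in> half_plane" for \<zeta>
  proof -
    define k where "k = - \<lfloor>Im \<zeta> / p\<rfloor>"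
    define \<xi> where "\<xi> = \<zeta> + \<i> * of_real (of_int k * p)"
    have "G \<xi> = G \<zeta>" unfolding \<xi>_def using per \<zeta> by (rule log_lift_int_period)
    moreover have "of_int (- k) \<le> Im \<zeta> / p" "Im \<zeta> / p < of_int (- k) + 1" unfolding k_def by linarith+
    hence "of_int (- k) * p \<le> Im \<zeta>" "Im \<zeta> < (of_int (- k) + 1) * p"
      using p by (simp_all only: pos_le_divide_eq pos_divide_less_eq)
    hence "0 \<le> Im \<xi>" "Im \<xi> \<le> p" by (simp_all add: \<xi>_def algebra_simps)
    moreover have "Re \<xi> = Re \<zeta>" by (simp add: \<xi>_def)
    ultimately show ?thesis by blast
  qed
  have box: "compact (G ` cbox (Complex b 0) (Complex c p))" for b
  proof -
    have "cbox (Complex b 0) (Complex c p) \<subseteq> half_plane" by (auto simp: in_cbox_complex_iff c_def)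
    from compact_continuous_image[OF continuous_on_subset[OF cont this] compact_cbox] show ?thesis .
  qed
  obtain M where M: "\<And>\<zeta>. \<zeta> \<in> cbox (Complex c 0) (Complex c p) \<Longrightarrow> cmod (G \<zeta>) \<le> M"
    using compact_imp_bounded[OF box[of c]] unfolding bounded_iff by blast
  define E where "E = - cball (0::complex) M"
  have E: "z \<in> E \<longleftrightarrow> M < cmod z" for z by (auto simp: E_def)
  have connE: "connected E" unfolding E_def
    by (rule connected_complement_bounded_convex) auto
  have "open Y"
    unfolding Y_def
  proof (rule open_mapping_thm[of G "{\<zeta>. Re \<zeta> < c}"])
    show "G holomorphic_on {\<zeta>. Re \<zeta> < c}" using hol by (rule holomorphic_on_subset) (auto simp: c_def)
    show "open {\<zeta>. Re \<zeta> < c}" "open {\<zeta>. Re \<zeta> < c}" by (rule open_halfspace_Re_lt)+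
    show "connected {\<zeta>. Re \<zeta> < c}" by (rule convex_connected[OF convex_halfspace_Re_lt])
    show "\<not> G constant_on {\<zeta>. Re \<zeta> < c}"
    proof
      assume "G constant_on {\<zeta>. Re \<zeta> < c}"
      then obtain g where "\<And>\<zeta>. Re \<zeta> < c \<Longrightarrow> G \<zeta> = g" unfolding constant_on_def by blast
      hence "G (of_real (c - 1)) = G (of_real (c - 2))" by simp
      moreover have "f (G (of_real (c - 1))) = s + exp (of_real (c - 1))" by (intro fG c_sub) simp
      moreover have "f (G (of_real (c - 2))) = s + exp (of_real (c - 2))" by (intro fG c_sub) simp
      ultimately have "exp (complex_of_real (c - 1)) = exp (complex_of_real (c - 2))" by simp
      hence "exp (c - 1) = exp (c - 2)" by (simp only: exp_of_real of_real_eq_iff)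
      thus False by simp
    qed
  qed simp
  moreover have "open (E - Y)"
  proof (rule openI)
    fix z assume z: "z \<in> E - Y"
    obtain c1 where c1: "\<And>\<zeta>. 0 \<le> Im \<zeta> \<Longrightarrow> Im \<zeta> \<le> p \<Longrightarrow> Re \<zeta> \<le> c1 \<Longrightarrow> cmod z + 1 < cmod (G \<zeta>)"
      using log_lift_uniformly_large[OF lim] by blast
    define Q where "Q = cbox (Complex c1 0) (Complex c p)"
    have "open (- (G ` Q))" unfolding Q_def by (intro open_Compl compact_imp_closed box)
    moreover have "z \<notin> G ` Q"
    proof
      assume "z \<in> G ` Q"
      then obtain \<zeta> where \<zeta>: "\<zeta> \<in> Q" "z = G \<zeta>" by blast
      show False
      proof (cases "Re \<zeta> < c")
        case True
        with \<zeta> z show False by (auto simp: Y_def)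
      next
        case False
        with \<zeta>(1) have "\<zeta> \<in> cbox (Complex c 0) (Complex c p)" by (simp add: Q_def in_cbox_complex_iff)
        from M[OF this] z \<zeta>(2) show False by (simp add: E)
      qed
    qed
    ultimately obtain e where e: "0 < e" "ball z e \<subseteq> - (G ` Q)" by (meson ComplI open_contains_ball)
    define d where "d = min e (min 1 (cmod z - M))"
    have "y \<in> E - Y" if y: "y \<in> ball z d" for y
    proof -
      have yz: "cmod (z - y) < e" "cmod (z - y) < 1" "cmod (z - y) < cmod z - M"
        using y by (simp_all add: d_def dist_norm)
      have n1: "cmod z - cmod y \<le> cmod (z - y)" by (rule norm_triangle_ineq2)
      have n2: "cmod y - cmod z \<le> cmod (z - y)" by (metis norm_minus_commute norm_triangle_ineq2)
      have "y \<in> E" using yz n1 by (simp add: E)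
      moreover have "y \<notin> Y"
      proof
        assume "y \<in> Y"
        then obtain \<zeta> where \<zeta>: "Re \<zeta> < c" "y = G \<zeta>" by (auto simp: Y_def)
        obtain \<xi> where \<xi>: "Re \<xi> = Re \<zeta>" "0 \<le> Im \<xi>" "Im \<xi> \<le> p" "G \<xi> = y"
          using reduce[of \<zeta>] c_sub[of \<zeta>] \<zeta> by auto
        have "\<not> Re \<xi> \<le> c1"
        proof
          assume "Re \<xi> \<le> c1"
          from c1[OF \<xi>(2,3) this] \<xi>(4) yz(2) n2 show False by simp
        qed
        hence "\<xi> \<in> Q" using \<xi> \<zeta>(1) by (simp add: Q_def in_cbox_complex_iff)
        hence "y \<in> G ` Q" using \<xi>(4) by blast
        moreover have "y \<in> ball z e" using yz(1) by (simp add: dist_norm)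
        ultimately show False using e(2) by blast
      qed
      ultimately show ?thesis by blast
    qed
    moreover have "0 < d" using e(1) z by (simp add: d_def E)
    ultimately show "\<exists>e>0. ball z e \<subseteq> E - Y" by blast
  qed
  ultimately have "Y \<inter> E = {} \<or> (E - Y) \<inter> E = {}"
    using connE by (intro connectedD) blast+
  moreover have "Y \<inter> E \<noteq> {}"
  proof -
    obtain c1 where c1: "\<And>\<zeta>. 0 \<le> Im \<zeta> \<Longrightarrow> Im \<zeta> \<le> p \<Longrightarrow> Re \<zeta> \<le> c1 \<Longrightarrow> M < cmod (G \<zeta>)"
      using log_lift_uniformly_large[OF lim] by blast
    define \<zeta> where "\<zeta> = complex_of_real (min c1 c - 1)"
    have "G \<zeta> \<in> E" unfolding E by (rule c1) (use p in \<open>auto simp: \<zeta>_def\<close>)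
    moreover have "G \<zeta> \<in> Y" unfolding Y_def by (rule imageI) (simp add: \<zeta>_def)
    ultimately show ?thesis by blast
  qed
  ultimately have EY: "E \<subseteq> Y" by blast
  have "z \<in> G ` half_plane" if "M < cmod z" for z
  proof -
    have "z \<in> Y" using EY that E by blast
    thus ?thesis unfolding Y_def using c_sub by (auto intro: less_imp_le)
  qed
  thus ?thesis using that by blast
qed

text \<open>
  If \<open>G\<close> is not injective, two points with the same image differ by a multiple of \<open>2\<pi>\<i>\<close>, and this
  multiple is a period by uniqueness of lifts.
\<close>
lemma log_lift_alternatives:
  assumes G: "log_lift G"
  obtains (extends) K where "inverse_branch f (ball s r) K" "\<And>\<zeta>. \<zeta> \<in> half_plane \<Longrightarrow> G \<zeta> = K (s + exp \<zeta>)"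
  | (bounded) M where "\<And>z. M < cmod z \<Longrightarrow> \<not> is_pole f z \<and> f z \<in> ball s r"
proof (cases "\<forall>\<theta>. filterlim (log_branch G \<theta>) at_infinity (at s within ball (tangent_center \<theta>) (r / 2))")
  case False
  then obtain \<theta> where "\<not> filterlim (log_branch G \<theta>) at_infinity (at s within ball (tangent_center \<theta>) (r / 2))"
    by blast
  from log_lift_extends_over_center[OF G this] show ?thesis using extends by blast
next
  case True
  hence lim: "\<And>\<theta>. filterlim (log_branch G \<theta>) at_infinity (at s within ball (tangent_center \<theta>) (r / 2))" by blast
  have fG: "f (G \<zeta>) = s + exp \<zeta>" "\<not> is_pole f (G \<zeta>)" if "\<zeta> \<in> half_plane" for \<zeta>
    using G that by (simp_all add: log_lift_def)
  have "\<not> inj_on G half_plane" by (rule log_lift_not_injective[OF G lim])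
  then obtain x y where xy: "x \<in> half_plane" "y \<in> half_plane" "G x = G y" "x \<noteq> y" unfolding inj_on_def by blast
  have "exp x = exp y" using fG(1)[OF xy(1)] fG(1)[OF xy(2)] xy(3) by simp
  then obtain n :: int where n: "x = y + of_real (of_int (2 * n) * pi) * \<i>" unfolding exp_eq by blast
  have "n \<noteq> 0" using n xy(4) by auto
  \<comment> \<open>Exchanging the two points makes the multiple positive.\<close>
  obtain u v and k :: int where k: "0 < k" "u = v + of_real (of_int (2 * k) * pi) * \<i>" "v \<in> half_plane" "G u = G v"
  proof (cases "0 < n")
    case True
    show ?thesis using that[OF True n xy(2,3)] .
  next
    case False
    have "0 < - n" using False \<open>n \<noteq> 0\<close> by simp
    moreover have "y = x + of_real (of_int (2 * (- n)) * pi) * \<i>" using n by simp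
    ultimately show ?thesis using that[of "- n" y x] xy(1) xy(3)[symmetric] by blast
  qed
  define p where "p = of_int (2 * k) * pi"
  have p: "0 < p" using k(1) by (simp add: p_def)
  have shift: "\<zeta> + \<i> * of_real p \<in> half_plane" if "\<zeta> \<in> half_plane" for \<zeta> using that by simp
  have shift_exp: "exp (\<zeta> + \<i> * of_real p) = exp \<zeta>" for \<zeta>
    unfolding exp_eq p_def by (rule exI[of _ k]) simp
  have contG: "continuous_on half_plane G" using G holomorphic_on_imp_continuous_on by (simp add: log_lift_def)
  have contS: "continuous_on half_plane (\<lambda>\<zeta>. \<zeta> + \<i> * of_real p)" by (intro continuous_intros)
  have cont: "continuous_on half_plane (\<lambda>\<zeta>. G (\<zeta> + \<i> * of_real p))"
    by (rule continuous_on_compose2[OF contG contS]) (use shift in blast)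
  have per: "G (\<zeta> + \<i> * of_real p) = G \<zeta>" if "\<zeta> \<in> half_plane" for \<zeta>
  proof (rule log_lifts_agree[OF G cont _ k(3) _ that, symmetric])
    show "f (G (\<xi> + \<i> * of_real p)) = s + exp \<xi>" if "\<xi> \<in> half_plane" for \<xi>
      using fG(1)[OF shift[OF that]] shift_exp by simp
    show "G v = G (v + \<i> * of_real p)" using k(2,4) by (simp add: p_def mult.commute)
  qed
  obtain M where M: "\<And>z. M < cmod z \<Longrightarrow> z \<in> G ` half_plane"
    using periodic_log_lift_fills_neighbourhood_of_infinity[OF G lim p per] by blast
  have "\<not> is_pole f z \<and> f z \<in> ball s r" if z: "M < cmod z" for z
  proof -
    obtain \<zeta> where \<zeta>: "\<zeta> \<in> half_plane" "z = G \<zeta>" using M[OF z] by blast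
    show ?thesis using fG[OF \<zeta>(1)] exp_in_disc[OF \<zeta>(1)] \<zeta>(2) by simp
  qed
  thus ?thesis by (rule bounded)
qed

text \<open>
  When the second alternative fails, every point of the preimage of the disc lies in the image of a branch defined on
  the whole disc. These images are open and connected, and any two are equal or disjoint, so they are the components.
\<close>
lemma regular_value_or_bounded_near_infinity:
  obtains (regular) "regular_value f s"
  | (bounded) M where "\<And>z. M < cmod z \<Longrightarrow> \<not> is_pole f z \<and> f z \<in> ball s r"
proof (cases "\<exists>M. \<forall>z. M < cmod z \<longrightarrow> \<not> is_pole f z \<and> f z \<in> ball s r")
  case True
  thus ?thesis using bounded by blast
next
  case unbounded: False
  let ?F = "finite_preimage f (ball s r)"
  have sheet: "\<exists>K. inverse_branch f (ball s r) K \<and> z \<in> K ` ball s r" if z: "z \<in> ?F" for z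
  proof (cases "f z = s")
    case True
    have "\<not> is_pole f z" using z by (simp add: finite_preimage_def)
    from branch_through_center[OF this True] obtain K where "inverse_branch f (ball s r) K" "K s = z" .
    thus ?thesis using r by (metis centre_in_ball imageI)
  next
    case False
    hence "z \<in> finite_preimage f (ball s r - {s})" using z by (simp add: finite_preimage_def)
    then obtain G \<zeta> where G: "log_lift G" "\<zeta> \<in> half_plane" "G \<zeta> = z" by (rule log_lift_exists)
    from G(1) show ?thesis
    proof (cases rule: log_lift_alternatives)
      case (extends K)
      have "z = K (s + exp \<zeta>)" using extends(2)[OF G(2)] G(3) by simp
      moreover have "s + exp \<zeta> \<in> ball s r" using exp_in_disc[OF G(2)] by blast
      ultimately show ?thesis using extends(1) by blast
    next
      case (bounded M)
      thus ?thesis using unbounded by blast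
    qed
  qed
  have "conformal_isomorphism f V (ball s r)" if V: "V \<in> components ?F" for V
  proof -
    obtain z where z: "z \<in> V" using in_components_nonempty[OF V] by blast
    have VF: "V \<subseteq> ?F" using V by (rule in_components_subset)
    obtain K where K: "inverse_branch f (ball s r) K" "z \<in> K ` ball s r" using sheet z VF by blast
    note b = inverse_branchD[OF K(1)]
    have KF: "K ` ball s r \<subseteq> ?F" using inverse_branch_in_preimage[OF K(1) subset_refl] by blast
    have openK: "open (J ` ball s r)" if "inverse_branch f (ball s r) J" for J
      using inverse_branchD(1)[OF that] open_ball inverse_branch_inj[OF that] by (rule open_mapping_thm3)
    have connK: "connected (K ` ball s r)" using b(2) connected_ball by (rule connected_continuous_image)
    have same: "J ` ball s r = K ` ball s r"
      if J: "inverse_branch f (ball s r) J" and meet: "J ` ball s r \<inter> K ` ball s r \<noteq> {}" for J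
    proof -
      obtain x y where xy: "x \<in> ball s r" "y \<in> ball s r" "J x = K y" using meet by blast
      have "x = y" using inverse_branchD(4)[OF J xy(1)] b(4)[OF xy(2)] xy(3) by simp
      have "J w = K w" if "w \<in> ball s r" for w
        by (rule branches_agree[OF J K(1), of "ball s r" x]) (use xy \<open>x = y\<close> that in auto)
      thus ?thesis by (rule image_cong[OF refl])
    qed
    have "V = K ` ball s r"
    proof
      show "K ` ball s r \<subseteq> V"
        using components_maximal[OF V connK KF] z K(2) by blast
      define W where "W = \<Union>{J ` ball s r |J. inverse_branch f (ball s r) J \<and> J ` ball s r \<inter> K ` ball s r = {}}"
      have "open W" unfolding W_def using openK by (intro open_Union) blast
      moreover have "V \<subseteq> K ` ball s r \<union> W"
      proof
        fix y assume "y \<in> V"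
        then obtain J where J: "inverse_branch f (ball s r) J" "y \<in> J ` ball s r" using sheet VF by blast
        show "y \<in> K ` ball s r \<union> W"
        proof (cases "J ` ball s r \<inter> K ` ball s r = {}")
          case True
          thus ?thesis using J unfolding W_def by blast
        next
          case False
          thus ?thesis using same[OF J(1)] J(2) by blast
        qed
      qed
      moreover have "K ` ball s r \<inter> W \<inter> V = {}" unfolding W_def by blast
      moreover have "connected V" using V by (rule in_components_connected)
      ultimately have "K ` ball s r \<inter> V = {} \<or> W \<inter> V = {}"
        using openK[OF K(1)] by (intro connectedD)
      hence "W \<inter> V = {}" using z K(2) by blast
      thus "V \<subseteq> K ` ball s r" using \<open>V \<subseteq> K ` ball s r \<union> W\<close> by blast
    qed
    have "f holomorphic_on V"
      using holomorphic_off_poles by (rule holomorphic_on_subset) (use VF in \<open>auto simp: finite_preimage_def\<close>)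
    moreover have bij: "bij_betw f V (ball s r)"
    proof (rule bij_betw_byWitness[where f' = K])
      show "\<forall>x\<in>V. K (f x) = x" using b(4) unfolding \<open>V = K ` ball s r\<close> by auto
      show "\<forall>w\<in>ball s r. f (K w) = w" using b(4) by blast
      show "f ` V \<subseteq> ball s r" using VF by (auto simp: finite_preimage_def)
      show "K ` ball s r \<subseteq> V" using \<open>V = K ` ball s r\<close> by simp
    qed
    moreover have "inv_into V f holomorphic_on ball s r"
      using b(1)
    proof (rule holomorphic_transform)
      fix w assume w: "w \<in> ball s r"
      have "K w \<in> V" using w \<open>V = K ` ball s r\<close> by blast
      thus "K w = inv_into V f w"
        using inv_into_f_f[OF bij_betw_imp_inj_on[OF bij]] b(4)[OF w] by metis
    qed
    ultimately show ?thesis by (simp add: conformal_isomorphism_def)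
  qed
  hence "regular_value f s"
    unfolding regular_value_def using r by (intro exI[of _ "ball s r"]) simp
  thus ?thesis by (rule regular)
qed

end

section \<open>Meromorphic functions bounded near infinity\<close>

lemma finite_poles_bounded:
  assumes "f nicely_meromorphic_on UNIV" and "\<And>z. M < cmod z \<Longrightarrow> \<not> is_pole f z"
  shows "finite {z. is_pole f z}"
proof -
  have "{z. is_pole f z} sparse_in UNIV"
    using assms(1) meromorphic_on_imp_not_pole_cosparse[of f UNIV]
    by (simp add: nicely_meromorphic_on_def eventually_cosparse)
  hence "finite (cball 0 M \<inter> {z. is_pole f z})"
    using sparse_in_subset[of _ UNIV "cball 0 M"] by (intro sparse_in_compact_finite compact_cball) simp
  moreover have "{z. is_pole f z} \<subseteq> cball 0 M" using assms(2) by (auto simp: not_less[symmetric])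
  ultimately show ?thesis by (simp add: Int_absorb1)
qed

text \<open>
  Multiply by the product of the linear factors at the poles, each to the order of the pole,
  and remove the singularities.
\<close>
lemma clear_poles:
  assumes mero: "f nicely_meromorphic_on UNIV" and fin: "finite {z. is_pole f z}"
  obtains q :: "complex poly" and h where "q \<noteq> 0" "h holomorphic_on UNIV"
    "\<And>z. \<not> is_pole f z \<Longrightarrow> h z = poly q z * f z"
proof -
  let ?S = "{z. is_pole f z}"
  have "\<exists>n::nat. \<exists>l. ((\<lambda>z. (z - p) ^ n * f z) \<longlongrightarrow> l) (at p)" if "p \<in> ?S" for p
  proof -
    have pole: "is_pole f p" using that by simp
    have "isolated_singularity_at f p"
      using mero meromorphic_on_isolated_singularity[of f p]
      by (auto simp: nicely_meromorphic_on_def intro: meromorphic_on_subset)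
    then obtain r where r: "0 < r" "f analytic_on ball p r - {p}" unfolding isolated_singularity_at_def by blast
    have "f holomorphic_on ball p r - {p}" using r(2) by (rule analytic_imp_holomorphic)
    from zorder_exist_pole[OF this open_ball _ pole] r(1)
    obtain \<rho> where \<rho>: "0 < \<rho>" "zor_poly f p holomorphic_on cball p \<rho>"
      "\<And>w. w \<in> cball p \<rho> - {p} \<Longrightarrow> f w = zor_poly f p w / (w - p) ^ nat (- zorder f p)" by auto
    have "zor_poly f p holomorphic_on ball p \<rho>" using \<rho>(2) by (rule holomorphic_on_subset) auto
    hence "isCont (zor_poly f p) p"
      using \<rho>(1) by (intro analytic_at_imp_isCont) (auto simp: analytic_at_ball)
    hence "(zor_poly f p \<longlongrightarrow> zor_poly f p p) (at p)" by (rule isContD)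
    hence "((\<lambda>z. (z - p) ^ nat (- zorder f p) * f z) \<longlongrightarrow> zor_poly f p p) (at p)"
      using \<rho>(1)
    proof (rule Lim_transform_within)
      fix w assume w: "0 < dist w p" "dist w p < \<rho>"
      hence "w \<in> cball p \<rho> - {p}" by (auto simp: dist_commute)
      from \<rho>(3)[OF this] w(1) show "zor_poly f p w = (w - p) ^ nat (- zorder f p) * f w" by simp
    qed
    thus ?thesis by blast
  qed
  then obtain n where n: "\<And>p. p \<in> ?S \<Longrightarrow> \<exists>l. ((\<lambda>z. (z - p) ^ n p * f z) \<longlongrightarrow> l) (at p)" by metis
  define q where "q = (\<Prod>p\<in>?S. [:- p, 1:] ^ n p)"
  have q0: "q \<noteq> 0" unfolding q_def using fin by (simp add: prod_zero_iff)
  have an: "f analytic_on {z}" if "z \<notin> ?S" for z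
    using nicely_meromorphic_on_imp_analytic_at[OF mero] that by simp
  define F where "F z = poly q z * f z" for z
  have qan: "poly q analytic_on {z}" for z
    by (rule analytic_on_subset[OF _ subset_UNIV])
       (auto simp: analytic_on_open intro!: holomorphic_intros)
  have lim: "\<exists>l. (F \<longlongrightarrow> l) (at p)" if p: "p \<in> ?S" for p
  proof -
    obtain l where l: "((\<lambda>z. (z - p) ^ n p * f z) \<longlongrightarrow> l) (at p)" using n[OF p] by blast
    define R where "R = (\<Prod>a\<in>?S - {p}. [:- a, 1:] ^ n a)"
    have "q = [:- p, 1:] ^ n p * R" unfolding q_def R_def using fin p by (rule prod.remove)
    hence "F = (\<lambda>z. poly R z * ((z - p) ^ n p * f z))" by (auto simp: F_def fun_eq_iff algebra_simps)
    moreover have "((\<lambda>z. poly R z * ((z - p) ^ n p * f z)) \<longlongrightarrow> poly R p * l) (at p)"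
      by (intro tendsto_intros l)
    ultimately show ?thesis by auto
  qed
  define h where "h = remove_sings F"
  have "h analytic_on {z}" for z
  proof (cases "z \<in> ?S")
    case True
    obtain l where l: "(F \<longlongrightarrow> l) (at z)" using lim[OF True] by blast
    have "isolated_singularity_at F z"
    proof -
      have "isolated_singularity_at f z"
        using mero meromorphic_on_isolated_singularity[of f z] by (auto simp: nicely_meromorphic_on_def intro: meromorphic_on_subset)
      thus ?thesis unfolding F_def
        by (rule isolated_singularity_at_times[OF isolated_singularity_at_analytic[OF qan]])
    qed
    thus ?thesis unfolding h_def using l by (rule remove_sings_analytic_at[OF _ _])
  next
    case False
    have "F analytic_on {z}" unfolding F_def by (rule analytic_on_mult[OF qan an[OF False]])
    thus ?thesis unfolding h_def by (rule remove_sings_analytic_on)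
  qed
  hence "h holomorphic_on UNIV" by (intro analytic_imp_holomorphic) (subst analytic_on_analytic_at, blast)
  moreover have "h z = poly q z * f z" if "\<not> is_pole f z" for z
  proof -
    have "F analytic_on {z}" unfolding F_def using that by (intro analytic_on_mult qan an) simp
    thus ?thesis unfolding h_def by (simp add: remove_sings_at_analytic F_def)
  qed
  ultimately show ?thesis using q0 that by blast
qed

lemma holomorphic_polynomial_growth_is_poly:
  assumes "h holomorphic_on UNIV" and "\<And>z. A \<le> cmod z \<Longrightarrow> cmod (h z) \<le> D * cmod z ^ n"
  obtains p :: "complex poly" where "h = poly p"
proof -
  have "h z = poly (\<Sum>k\<le>n. monom ((deriv ^^ k) h 0 / fact k) k) z" for z
    using Liouville_polynomial[OF assms] by (simp add: poly_sum poly_monom)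
  thus ?thesis using that by blast
qed

lemma poly_growth_bound:
  fixes q :: "complex poly"
  obtains D where "0 \<le> D" "\<And>z. 1 \<le> cmod z \<Longrightarrow> cmod (poly q z) \<le> D * cmod z ^ degree q"
proof -
  define D where "D = (\<Sum>i\<le>degree q. cmod (coeff q i))"
  have "cmod (poly q z) \<le> D * cmod z ^ degree q" if z: "1 \<le> cmod z" for z
  proof -
    have "cmod (poly q z) \<le> (\<Sum>i\<le>degree q. cmod (coeff q i * z ^ i))"
      unfolding poly_altdef by (rule norm_sum)
    also have "\<dots> \<le> (\<Sum>i\<le>degree q. cmod (coeff q i) * cmod z ^ degree q)"
      using z by (intro sum_mono) (simp add: norm_mult norm_power mult_left_mono power_increasing)
    also have "\<dots> = D * cmod z ^ degree q" by (simp add: D_def sum_distrib_right)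
    finally show ?thesis .
  qed
  moreover have "0 \<le> D" by (simp add: D_def sum_nonneg)
  ultimately show ?thesis using that by blast
qed

text \<open>
  Clearing the poles leaves an entire function of polynomial growth, which is a polynomial.
\<close>
lemma bounded_near_infinity_imp_rational:
  assumes mero: "f nicely_meromorphic_on UNIV"
    and bd: "\<And>z. M < cmod z \<Longrightarrow> \<not> is_pole f z \<and> cmod (f z) \<le> A"
  shows "rational_function f"
proof -
  have "finite {z. is_pole f z}" using mero bd by (intro finite_poles_bounded[of f M]) blast+
  then obtain q h where q: "q \<noteq> 0" "h holomorphic_on UNIV" "\<And>z. \<not> is_pole f z \<Longrightarrow> h z = poly q z * f z"
    using clear_poles[OF mero] by metis
  obtain D where D: "0 \<le> D" "\<And>z. 1 \<le> cmod z \<Longrightarrow> cmod (poly q z) \<le> D * cmod z ^ degree q"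
    using poly_growth_bound[of q] by blast
  have growth: "cmod (h z) \<le> (\<bar>A\<bar> * D) * cmod z ^ degree q" if z: "max 1 (M + 1) \<le> cmod z" for z
  proof -
    have f: "\<not> is_pole f z" "cmod (f z) \<le> \<bar>A\<bar>" using bd[of z] z by auto
    have "cmod (h z) = cmod (poly q z) * cmod (f z)" using q(3)[OF f(1)] by (simp add: norm_mult)
    also have "\<dots> \<le> (D * cmod z ^ degree q) * \<bar>A\<bar>" using D z f(2) by (intro mult_mono) auto
    finally show ?thesis by (simp add: mult_ac)
  qed
  obtain p where p: "h = poly p" using holomorphic_polynomial_growth_is_poly[OF q(2) growth] .
  \<comment> \<open>The additional zeros exclude the poles, where the values of \<open>f\<close> are placeholders.\<close>
  define q2 where "q2 = q * (\<Prod>a\<in>{z. is_pole f z}. [:- a, 1:])"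
  define p2 where "p2 = p * (\<Prod>a\<in>{z. is_pole f z}. [:- a, 1:])"
  have fin: "finite {z. is_pole f z}" by fact
  have "q2 \<noteq> 0" unfolding q2_def using q(1) fin by (simp add: prod_zero_iff)
  moreover have "f z = poly p2 z / poly q2 z" if "poly q2 z \<noteq> 0" for z
  proof -
    have z: "poly q z \<noteq> 0" "poly (\<Prod>a\<in>{z. is_pole f z}. [:- a, 1:]) z \<noteq> 0" using that by (auto simp: q2_def)
    hence "\<not> is_pole f z" using fin by (auto simp: poly_prod prod_zero_iff)
    hence "poly p z = poly q z * f z" using q(3) p by simp
    thus ?thesis using z by (simp add: p2_def q2_def)
  qed
  ultimately show ?thesis unfolding rational_function_def by blast
qed

lemma entire_bounded_near_infinity_imp_poly:
  assumes hol: "f holomorphic_on UNIV" and bd: "\<And>z. M < cmod z \<Longrightarrow> cmod (f z) \<le> A"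
  obtains p :: "complex poly" where "f = poly p"
proof (rule holomorphic_polynomial_growth_is_poly[OF hol])
  show "cmod (f z) \<le> A * cmod z ^ 0" if "M + 1 \<le> cmod z" for z using bd[of z] that by simp
qed (rule that)

section \<open>The main theorem\<close>

lemma one_plus_powr_le_power:
  assumes "0 \<le> x" "0 < \<tau>" "\<tau> \<le> 2 * real m"
  shows "1 + x powr \<tau> \<le> 2 * (1 + x\<^sup>2) ^ m"
proof -
  have one: "1 \<le> (1 + x\<^sup>2) ^ m" by (intro one_le_power) simp
  have "x powr \<tau> \<le> (1 + x\<^sup>2) ^ m"
  proof (cases "x \<le> 1")
    case True
    hence "x powr \<tau> \<le> 1 powr \<tau>" using assms by (intro powr_mono2) auto
    hence "x powr \<tau> \<le> 1" by simp
    thus ?thesis using one by (rule order_trans)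
  next
    case False
    hence "x powr \<tau> \<le> x powr real (2 * m)" using assms by (intro powr_mono) auto
    also have "\<dots> = x ^ (2 * m)" using False by (intro powr_realpow) simp
    also have "\<dots> = (x\<^sup>2) ^ m" by (rule power_mult)
    also have "\<dots> \<le> (1 + x\<^sup>2) ^ m" by (intro power_mono) auto
    finally show ?thesis .
  qed
  with one show ?thesis by linarith
qed

text \<open>
  The contrapositive of the main result. After shrinking \<open>U\<close>, the alternative that \<open>f\<close> is bounded near
  infinity is incompatible with transcendence.
\<close>
theorem polynomial_expansion_imp_regular_value:
  fixes f :: "complex \<Rightarrow> complex"
  assumes trans: "transcendental_entire f \<or> transcendental_meromorphic f"
    and U: "open U" "s \<in> U" and C: "0 < C" and m: "0 < m"
    and expand: "\<And>z. z \<in> finite_preimage f U \<Longrightarrow> 1 \<le> C * (1 + (cmod z)\<^sup>2) ^ m * cmod (deriv f z)"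
  shows "regular_value f s"
proof -
  have mero: "f nicely_meromorphic_on UNIV"
    using trans
  proof
    assume "transcendental_entire f"
    hence "f analytic_on UNIV" by (simp add: transcendental_entire_def analytic_on_open)
    thus ?thesis by (rule analytic_on_imp_nicely_meromorphic_on)
  qed (simp add: transcendental_meromorphic_def)
  have expanding: "expanding_over f V C m" if V: "open V" "V \<subseteq> U" for V
  proof
    show "f nicely_meromorphic_on UNIV" by (rule mero)
    show "open V" by (rule V(1))
    fix z assume "z \<in> finite_preimage f V"
    hence "z \<in> finite_preimage f U" using V(2) by (auto simp: finite_preimage_def)
    from expand[OF this] show "1 \<le> C * (1 + (cmod z)\<^sup>2) ^ m * cmod (deriv f z)" .
    thus "deriv f z \<noteq> 0" by auto
  qed
  have fin: "finite (asymptotic_points f U)"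
    by (rule expanding_over.finite_asymptotic_points[OF expanding[OF U(1) subset_refl] m C])
  obtain e where e: "0 < e" "ball s e \<subseteq> U" using U open_contains_ball by blast
  obtain d where d: "0 < d" "\<And>x. x \<in> asymptotic_points f U \<Longrightarrow> x \<noteq> s \<Longrightarrow> d \<le> dist s x"
    using finite_set_avoid[OF fin, of s] by blast
  define r where "r = min e d"
  have r: "0 < r" "ball s r \<subseteq> U" using e d(1) by (auto simp: r_def)
  have "asymptotic_points f (ball s r) \<subseteq> {s}"
  proof
    fix x assume x: "x \<in> asymptotic_points f (ball s r)"
    hence "x \<in> ball s r" by (simp add: asymptotic_points_def)
    hence "dist s x < d" by (simp add: r_def)
    moreover have "x \<in> asymptotic_points f U" using x asymptotic_points_mono[OF r(2)] by blast
    ultimately show "x \<in> {s}" using d(2)[of x] by force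
  qed
  with r C m have "isolated_asymptotic_value f s r C m"
    by (intro isolated_asymptotic_value.intro isolated_asymptotic_value_axioms.intro expanding open_ball)
  then interpret isolated_asymptotic_value f s r C m .
  show ?thesis
  proof (cases rule: regular_value_or_bounded_near_infinity)
    case regular
    thus ?thesis .
  next
    case (bounded M)
    have bd: "\<not> is_pole f z \<and> cmod (f z) \<le> cmod s + r" if "M < cmod z" for z
    proof -
      have "cmod (f z - s) < r" using bounded[OF that] by (simp add: dist_norm norm_minus_commute)
      moreover have "cmod (f z) \<le> cmod s + cmod (f z - s)" using norm_triangle_ineq[of s "f z - s"] by simp
      ultimately show ?thesis using bounded[OF that] by simp
    qed
    from trans show ?thesis
    proof
      assume t: "transcendental_entire f"
      have "\<exists>p :: complex poly. f = poly p"
        using entire_bounded_near_infinity_imp_poly[of f M "cmod s + r"] bd t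
        unfolding transcendental_entire_def by metis
      thus ?thesis using t unfolding transcendental_entire_def by blast
    next
      assume t: "transcendental_meromorphic f"
      have "rational_function f" using bounded_near_infinity_imp_rational[OF mero bd] .
      thus ?thesis using t by (simp add: transcendental_meromorphic_def)
    qed
  qed
qed

theorem theorem1p5:
  fixes f :: "complex \<Rightarrow> complex" and s :: complex and U :: "complex set"
  assumes "transcendental_entire f \<or> transcendental_meromorphic f"
    and "s \<in> singular_values f"
    and "open U" and "s \<in> U"
  shows "\<forall>\<tau>::real. \<tau> > 0 \<longrightarrow>
           (INF z \<in> finite_preimage f U. ereal ((1 + cmod z powr \<tau>) * cmod (deriv f z))) = 0"
proof (intro allI impI, rule ccontr)
  fix \<tau> :: real
  assume \<tau>: "0 < \<tau>"
  define F where "F z = (1 + cmod z powr \<tau>) * cmod (deriv f z)" for z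
  assume "(INF z \<in> finite_preimage f U. ereal ((1 + cmod z powr \<tau>) * cmod (deriv f z))) \<noteq> 0"
  hence ne: "(INF z \<in> finite_preimage f U. ereal (F z)) \<noteq> 0" by (simp add: F_def)
  have "0 \<le> (INF z \<in> finite_preimage f U. ereal (F z))"
    by (intro INF_greatest) (simp add: F_def)
  with ne have "0 < (INF z \<in> finite_preimage f U. ereal (F z))" by simp
  then obtain c where c: "ereal 0 < ereal c" "ereal c < (INF z \<in> finite_preimage f U. ereal (F z))"
    using ereal_dense2[of "0" "INF z \<in> finite_preimage f U. ereal (F z)"] by (auto simp: zero_ereal_def)
  have cF: "c \<le> F z" if "z \<in> finite_preimage f U" for z
    using less_INF_D[OF c(2) that] by simp
  define m where "m = nat \<lceil>\<tau>\<rceil>"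
  have m: "0 < m" "\<tau> \<le> 2 * real m" using \<tau> unfolding m_def by linarith+
  have "regular_value f s"
  proof (rule polynomial_expansion_imp_regular_value[OF assms(1,3,4) _ m(1)])
    show "0 < 2 / c" using c(1) by simp
    fix z assume z: "z \<in> finite_preimage f U"
    have "c \<le> (2 * (1 + (cmod z)\<^sup>2) ^ m) * cmod (deriv f z)"
      using cF[OF z] mult_right_mono[OF one_plus_powr_le_power[OF _ \<tau> m(2), of "cmod z"], of "cmod (deriv f z)"]
      by (simp add: F_def)
    thus "1 \<le> 2 / c * (1 + (cmod z)\<^sup>2) ^ m * cmod (deriv f z)"
      using c(1) by (simp add: field_simps)
  qed
  thus False using assms(2) by (simp add: singular_values_def)
qed

end
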